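(* Let $\mathbf{P}$ be a quasivariety (not assumed residually small) and $\kappa$ a cardinal. Consider the conditions: (1) Every set $\mathbf{X}$ of subdirectly irreducible algebras in $\mathbf{P}$ can be written as the union of $\leq\kappa$ subsets $\mathbf{X}_\alpha$ $(\alpha\in\kappa)$, each of which is $\mathbf{P}$-compatible. (2) $\mathbf{P}$ can be generated as a quasivariety by $\leq\kappa$ algebras. Then (1) implies (2). The reverse implication, from (2) to (1), holds for all quasivarieties $\mathbf{P}$ if $\kappa$ is finite, but not for any infinite $\kappa$ (that is, for every infinite cardinal $\kappa$ there is a quasivariety $\mathbf{P}$ which satisfies (2) but not (1)).
   Context: The empty algebra is admitted when there are no zeroary operations. A prevariety is a class of algebras of a given type closed under passing to algebras isomorphic to subalgebras and to algebras isomorphic to direct products of (possibly empty) families. A quasivariety is a prevariety of finitary algebras (all primitive operations of finite arity) that is closed under ultraproducts; equivalently, that is definable by conditions $(\forall x\in A^I)\ (\bigwedge_{j\in J}a_j(x)=b_j(x))\Rightarrow c(x)=d(x)$ with $I,J$ finite and $a_j,b_j,c,d$ terms. The quasivariety generated by a class $\mathbf{X}$ of finitary algebras of the same type is the least quasivariety containing $\mathbf{X}$. A prevariety is residually small if it can be generated as a prevariety by a set of algebras. A subdirect product of a (possibly empty) family $(B_i)_{i\in I}$ is a subalgebra of $\prod_I B_i$ which projects surjectively to each $B_i$. An algebra in $\mathbf{P}$ is subdirectly irreducible (in $\mathbf{P}$) if it cannot be expressed, up to isomorphism, as a subdirect product of a family of algebras in $\mathbf{P}$ without one of the projection maps being an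 isomorphism. A set $\mathbf{X}$ of algebras in $\mathbf{P}$ is called $\mathbf{P}$-compatible if for every $A_0\in\mathbf{X}$ the coprojection map from $A_0$ to the coproduct in $\mathbf{P}$ of all $A\in\mathbf{X}$ is one-to-one; equivalently, if there exists an algebra $B$ in $\mathbf{P}$ admitting one-to-one homomorphisms $A\to B$ for all $A\in\mathbf{X}$. *)

theory Defs
  imports "HOL-Library.FuncSet"
begin

unbundle cardinal_syntax

section \<open>Finitary signatures, terms and algebras\<close>

(* The symbols form a set rather than a whole type, so that the empty signature is included.
   All arities are finite; zeroary symbols are those of arity 0. *)
record 'f signature =
  syms :: "'f set"
  arity :: "'f \<Rightarrow> nat"

datatype ('f, 'v) trm = Var 'v | App 'f "('f, 'v) trm list"

fun wf_trm :: "'f signature \<Rightarrow> 'v set \<Rightarrow> ('f, 'v) trm \<Rightarrow> bool" where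
  "wf_trm S V (Var v) \<longleftrightarrow> v \<in> V"
| "wf_trm S V (App f ts) \<longleftrightarrow>
     f \<in> syms S \<and> length ts = arity S f \<and> (\<forall>t \<in> set ts. wf_trm S V t)"

(* Only the values of the operations on argument lists of the right length over the
   underlying set matter. *)
record ('f, 'a) algebra =
  elts :: "'a set"
  op_on :: "'f \<Rightarrow> 'a list \<Rightarrow> 'a"

(* The underlying set may be empty; closure rules this out if there is a zeroary symbol. *)
definition is_algebra :: "'f signature \<Rightarrow> ('f, 'a) algebra \<Rightarrow> bool" where
  "is_algebra S A \<longleftrightarrow>
     (\<forall>f \<in> syms S. \<forall>xs. length xs = arity S f \<and> set xs \<subseteq> elts A \<longrightarrow> op_on A f xs \<in> elts A)"

fun val :: "('f, 'a) algebra \<Rightarrow> ('v \<Rightarrow> 'a) \<Rightarrow> ('f, 'v) trm \<Rightarrow> 'a" where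
  "val A x (Var v) = x v"
| "val A x (App f ts) = op_on A f (map (val A x) ts)"

definition alg_hom :: "'f signature \<Rightarrow> ('f, 'a) algebra \<Rightarrow> ('f, 'b) algebra \<Rightarrow> ('a \<Rightarrow> 'b) \<Rightarrow> bool" where
  "alg_hom S A B h \<longleftrightarrow>
     h \<in> elts A \<rightarrow> elts B \<and>
     (\<forall>f \<in> syms S. \<forall>xs. length xs = arity S f \<and> set xs \<subseteq> elts A \<longrightarrow>
        h (op_on A f xs) = op_on B f (map h xs))"

definition embedding ::
    "'f signature \<Rightarrow> ('f, 'a) algebra \<Rightarrow> ('f, 'b) algebra \<Rightarrow> ('a \<Rightarrow> 'b) \<Rightarrow> bool" where
  "embedding S A B h \<longleftrightarrow> alg_hom S A B h \<and> inj_on h (elts A)"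

definition alg_iso :: "'f signature \<Rightarrow> ('f, 'a) algebra \<Rightarrow> ('f, 'b) algebra \<Rightarrow> ('a \<Rightarrow> 'b) \<Rightarrow> bool" where
  "alg_iso S A B h \<longleftrightarrow> alg_hom S A B h \<and> bij_betw h (elts A) (elts B)"

definition subalgebra :: "'f signature \<Rightarrow> ('f, 'a) algebra \<Rightarrow> ('f, 'a) algebra \<Rightarrow> bool" where
  "subalgebra S D A \<longleftrightarrow>
     is_algebra S D \<and> elts D \<subseteq> elts A \<and>
     (\<forall>f \<in> syms S. \<forall>xs. length xs = arity S f \<and> set xs \<subseteq> elts D \<longrightarrow>
        op_on D f xs = op_on A f xs)"

definition prod_algebra :: "'i set \<Rightarrow> ('i \<Rightarrow> ('f, 'a) algebra) \<Rightarrow> ('f, 'i \<Rightarrow> 'a) algebra" where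
  "prod_algebra I B =
     \<lparr>elts = (\<Pi>\<^sub>E i\<in>I. elts (B i)),
      op_on = (\<lambda>f xs. \<lambda>i\<in>I. op_on (B i) f (map (\<lambda>x. x i) xs))\<rparr>"

definition subdirect_product ::
    "'f signature \<Rightarrow> 'i set \<Rightarrow> ('i \<Rightarrow> ('f, 'a) algebra) \<Rightarrow> ('f, 'i \<Rightarrow> 'a) algebra \<Rightarrow> bool" where
  "subdirect_product S I B D \<longleftrightarrow>
     subalgebra S D (prod_algebra I B) \<and> (\<forall>i \<in> I. (\<lambda>x. x i) ` elts D = elts (B i))"


section \<open>Quasivarieties\<close>

(* QI I ps (c, d) stands for the condition
   (ALL x in A^I) (/\ (a, b) in ps. a(x) = b(x)) ==> c(x) = d(x). *)
datatype 'f quasi_identity =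
  QI "nat set" "(('f, nat) trm \<times> ('f, nat) trm) list" "('f, nat) trm \<times> ('f, nat) trm"

fun wf_qi :: "'f signature \<Rightarrow> 'f quasi_identity \<Rightarrow> bool" where
  "wf_qi S (QI I ps (c, d)) \<longleftrightarrow>
     finite I \<and> (\<forall>(a, b) \<in> set ps. wf_trm S I a \<and> wf_trm S I b) \<and> wf_trm S I c \<and> wf_trm S I d"

fun satisfies :: "('f, 'a) algebra \<Rightarrow> 'f quasi_identity \<Rightarrow> bool" where
  "satisfies A (QI I ps (c, d)) \<longleftrightarrow>
     (\<forall>x \<in> I \<rightarrow> elts A. (\<forall>(a, b) \<in> set ps. val A x a = val A x b) \<longrightarrow> val A x c = val A x d)"

(* A quasivariety is a proper class, with members over arbitrary carrier types, so it cannot be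
   a single HOL set. It is represented by a set E of quasi-identities defining it; its members
   over the carrier type 'a form the set models S E :: ('f, 'a) algebra set. *)
definition quasi_identities :: "'f signature \<Rightarrow> 'f quasi_identity set \<Rightarrow> bool" where
  "quasi_identities S E \<longleftrightarrow> (\<forall>q \<in> E. wf_qi S q)"

definition models :: "'f signature \<Rightarrow> 'f quasi_identity set \<Rightarrow> ('f, 'a) algebra set" where
  "models S E = {A. is_algebra S A \<and> (\<forall>q \<in> E. satisfies A q)}"

(* Inclusion between the classes defined by E and E'. It suffices to compare members over the
   carrier type ('f, nat) trm: see small_equivalent_algebra and quasivariety_le_universal. *)
definition quasivariety_le ::
    "'f signature \<Rightarrow> 'f quasi_identity set \<Rightarrow> 'f quasi_identity set \<Rightarrow> bool" where
  "quasivariety_le S E E' \<longleftrightarrow> (models S E :: ('f, ('f, nat) trm) algebra set) \<subseteq> models S E'"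

(* E defines the least quasivariety containing G. *)
definition generated_by ::
    "'f signature \<Rightarrow> 'f quasi_identity set \<Rightarrow> ('f, 'a) algebra set \<Rightarrow> bool" where
  "generated_by S E G \<longleftrightarrow>
     G \<subseteq> models S E \<and>
     (\<forall>E'. quasi_identities S E' \<and> G \<subseteq> models S E' \<longrightarrow> quasivariety_le S E E')"

(* The carrier type ('f, nat) trm of the generators is no restriction: see
   generated_by_at_most_universal. *)
definition generated_by_at_most ::
    "'f signature \<Rightarrow> 'f quasi_identity set \<Rightarrow> 'k rel \<Rightarrow> bool" where
  "generated_by_at_most S E \<kappa> \<longleftrightarrow>
     (\<exists>G :: ('f, ('f, nat) trm) algebra set. |G| \<le>o \<kappa> \<and> generated_by S E G)"


section \<open>Subdirect irreducibility and compatibility\<close>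

(* The factors of a subdirect decomposition of A are homomorphic images of A, and a subfamily
   indexed by pairs of elements already separates points. Hence carrier type 'a and index type
   'a * 'a are no restriction: see subdirectly_irreducible_universal. *)
definition subdirectly_irreducible ::
    "'f signature \<Rightarrow> 'f quasi_identity set \<Rightarrow> ('f, 'a) algebra \<Rightarrow> bool" where
  "subdirectly_irreducible S E A \<longleftrightarrow>
     A \<in> models S E \<and>
     (\<forall>(I :: ('a \<times> 'a) set) (B :: 'a \<times> 'a \<Rightarrow> ('f, 'a) algebra) D h.
        (\<forall>i \<in> I. B i \<in> models S E) \<and> subdirect_product S I B D \<and> alg_iso S A D h \<longrightarrow>
        (\<exists>i \<in> I. alg_iso S D (B i) (\<lambda>x. x i)))"

(* An algebra generated by images of all members of X consists of values of terms in the symbols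
   (A, a) with A in X and a in A, so the carrier type of B is no restriction: see
   compatible_universal. *)
definition compatible ::
    "'f signature \<Rightarrow> 'f quasi_identity set \<Rightarrow> ('f, 'a) algebra set \<Rightarrow> bool" where
  "compatible S E X \<longleftrightarrow>
     (\<exists>B :: ('f, ('f, ('f, 'a) algebra \<times> 'a) trm) algebra.
        B \<in> models S E \<and> (\<forall>A \<in> X. \<exists>h. embedding S A B h))"

(* Quantifies over sets X of algebras whose elements lie in the type 'a. *)
definition si_sets_covered ::
    "'a itself \<Rightarrow> 'f signature \<Rightarrow> 'f quasi_identity set \<Rightarrow> 'k rel \<Rightarrow> bool" where
  "si_sets_covered _ S E \<kappa> \<longleftrightarrow>
     (\<forall>X :: ('f, 'a) algebra set. (\<forall>A \<in> X. subdirectly_irreducible S E A) \<longrightarrow>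
        (\<exists>Y. X = (\<Union>\<alpha> \<in> Field \<kappa>. Y \<alpha>) \<and> (\<forall>\<alpha> \<in> Field \<kappa>. compatible S E (Y \<alpha>))))"


section \<open>Independence of the chosen carrier types\<close>

lemma is_algebraD:
  "is_algebra S A \<Longrightarrow> f \<in> syms S \<Longrightarrow> length xs = arity S f \<Longrightarrow> set xs \<subseteq> elts A \<Longrightarrow>
    op_on A f xs \<in> elts A"
  by (simp add: is_algebra_def)

lemma alg_homD:
  "alg_hom S A B h \<Longrightarrow> f \<in> syms S \<Longrightarrow> length xs = arity S f \<Longrightarrow> set xs \<subseteq> elts A \<Longrightarrow>
    h (op_on A f xs) = op_on B f (map h xs)"
  by (simp add: alg_hom_def)

lemma val_wf_in:
  assumes "is_algebra S B" "wf_trm S V t" "v \<in> V \<rightarrow> elts B"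
  shows "val B v t \<in> elts B"
  using assms(2)
proof (induction t)
  case (Var x) then show ?case using assms(3) by auto
next
  case (App f ts)
  have "set (map (val B v) ts) \<subseteq> elts B" using App by auto
  moreover have "length (map (val B v) ts) = arity S f" "f \<in> syms S" using App by auto
  ultimately show ?case using assms(1) unfolding is_algebra_def by simp
qed

lemma val_hom:
  assumes "is_algebra S A" "alg_hom S A B h" "wf_trm S V t" "v \<in> V \<rightarrow> elts A"
  shows "h (val A v t) = val B (h \<circ> v) t"
  using assms(3)
proof (induction t)
  case (Var x) then show ?case by simp
next
  case (App f ts)
  have wf: "\<forall>t \<in> set ts. wf_trm S V t" using App by auto
  have "set (map (val A v) ts) \<subseteq> elts A" using wf val_wf_in[OF assms(1) _ assms(4)] by auto
  moreover have "length (map (val A v) ts) = arity S f" "f \<in> syms S" using App by auto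
  ultimately have "h (op_on A f (map (val A v) ts)) = op_on B f (map h (map (val A v) ts))"
    using assms(2) unfolding alg_hom_def by blast
  also have "map h (map (val A v) ts) = map (val B (h \<circ> v)) ts"
    unfolding map_map by (rule map_cong[OF refl]) (use App.IH wf in \<open>metis comp_apply\<close>)
  finally show ?case by (simp only: val.simps)
qed

lemma satisfies_embedding:
  assumes A: "is_algebra S A" and h: "embedding S A B h" and q: "wf_qi S q" and s: "satisfies B q"
  shows "satisfies A q"
proof (cases q)
  case (QI I ps cd)
  obtain c d where cd: "cd = (c, d)" by fastforce
  have hh: "alg_hom S A B h" and inj: "inj_on h (elts A)" using h by (auto simp: embedding_def)
  have wf: "\<forall>(a, b) \<in> set ps. wf_trm S I a \<and> wf_trm S I b" "wf_trm S I c" "wf_trm S I d"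
    using q QI cd by auto
  have "val A x c = val A x d"
    if x: "x \<in> I \<rightarrow> elts A" and p: "\<forall>(a, b) \<in> set ps. val A x a = val A x b" for x
  proof -
    have hx: "h \<circ> x \<in> I \<rightarrow> elts B" using x hh by (auto simp: alg_hom_def)
    have v: "h (val A x t) = val B (h \<circ> x) t" if "wf_trm S I t" for t
      using val_hom[OF A hh that x] .
    have "\<forall>(a, b) \<in> set ps. val B (h \<circ> x) a = val B (h \<circ> x) b"
    proof clarify
      fix a b assume ab: "(a, b) \<in> set ps"
      then have "wf_trm S I a" "wf_trm S I b" "val A x a = val A x b" using wf(1) p by auto
      then show "val B (h \<circ> x) a = val B (h \<circ> x) b" using v by metis
    qed
    then have "val B (h \<circ> x) c = val B (h \<circ> x) d" using s hx QI cd by auto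
    then have "h (val A x c) = h (val A x d)" using v wf by simp
    then show ?thesis using inj val_wf_in[OF A _ x] wf by (auto dest: inj_onD)
  qed
  then show ?thesis using QI cd by simp
qed

lemma models_embedding:
  assumes "is_algebra S A" "embedding S A B h" "B \<in> models S E" "quasi_identities S E"
  shows "A \<in> models S E"
  using assms satisfies_embedding[OF assms(1,2)] unfolding models_def quasi_identities_def by blast

lemma algebra_transport:
  assumes B: "is_algebra S B" and C: "C \<subseteq> elts B"
    and cl: "\<And>f xs. f \<in> syms S \<Longrightarrow> length xs = arity S f \<Longrightarrow> set xs \<subseteq> C \<Longrightarrow> op_on B f xs \<in> C"
    and r: "\<And>b. b \<in> C \<Longrightarrow> e (r b) = b"
  defines "B' \<equiv> \<lparr>elts = r ` C, op_on = (\<lambda>f ts. r (op_on B f (map e ts)))\<rparr>"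
  shows "is_algebra S B'" "embedding S B' B e" "e ` elts B' = C"
proof -
  have e: "set (map e xs) \<subseteq> C" if "set xs \<subseteq> r ` C" for xs using that r by fastforce
  show "is_algebra S B'"
    unfolding is_algebra_def B'_def
  proof (intro ballI allI impI; simp)
    fix f xs assume "f \<in> syms S" "length xs = arity S f \<and> set xs \<subseteq> r ` C"
    then have "op_on B f (map e xs) \<in> C" using cl[of f "map e xs"] e[of xs] by simp
    then show "r (op_on B f (map e xs)) \<in> r ` C" by simp
  qed
  have "alg_hom S B' B e"
    unfolding alg_hom_def B'_def
  proof (intro conjI ballI allI impI; simp)
    show "e \<in> r ` C \<rightarrow> elts B" using r C by auto
    fix f xs assume "f \<in> syms S" "length xs = arity S f \<and> set xs \<subseteq> r ` C"
    then have "op_on B f (map e xs) \<in> C" using cl[of f "map e xs"] e[of xs] by simp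
    then show "e (r (op_on B f (map e xs))) = op_on B f (map e xs)" using r by simp
  qed
  moreover have "inj_on e (elts B')" unfolding B'_def using r by (auto simp: inj_on_def)
  ultimately show "embedding S B' B e" by (simp add: embedding_def)
  show "e ` elts B' = C" unfolding B'_def using r by force
qed

lemma generated_subalgebra:
  assumes B: "is_algebra S B" and v: "v \<in> V \<rightarrow> elts B" and inj: "inj_on enc {t. wf_trm S V t}"
  obtains B' e where "is_algebra S B'" "embedding S B' B e" "v ` V \<subseteq> e ` elts B'"
    "elts B' \<subseteq> enc ` {t. wf_trm S V t}"
proof -
  let ?T = "{t. wf_trm S V t}"
  let ?C = "val B v ` ?T"
  define r where "r b = enc (SOME t. wf_trm S V t \<and> val B v t = b)" for b
  define e where "e c = val B v (inv_into ?T enc c)" for c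
  have s: "wf_trm S V (SOME t. wf_trm S V t \<and> val B v t = b) \<and>
      val B v (SOME t. wf_trm S V t \<and> val B v t = b) = b" if "b \<in> ?C" for b
    by (rule someI_ex) (use that in auto)
  have er: "e (r b) = b" if "b \<in> ?C" for b
    unfolding e_def r_def using s[OF that] inj by (simp add: inv_into_f_f)
  have sub: "?C \<subseteq> elts B" using val_wf_in[OF B _ v] by auto
  have cl: "op_on B f xs \<in> ?C" if "f \<in> syms S" "length xs = arity S f" "set xs \<subseteq> ?C" for f xs
  proof -
    let ?g = "inv_into ?T (val B v)"
    have g: "val B v (?g b) = b" "wf_trm S V (?g b)" if "b \<in> ?C" for b
      using f_inv_into_f[OF that] inv_into_into[OF that] by simp_all
    have "map (val B v) (map ?g xs) = xs"
      unfolding map_map by (rule map_idI) (use g(1) that(3) in \<open>simp add: subset_iff\<close>)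
    then have "op_on B f xs = val B v (App f (map ?g xs))" by (simp only: val.simps)
    moreover have "App f (map ?g xs) \<in> ?T" using that g(2) by (simp add: subset_iff)
    ultimately show ?thesis by (rule image_eqI)
  qed
  define B' where "B' = \<lparr>elts = r ` ?C, op_on = (\<lambda>f ts. r (op_on B f (map e ts)))\<rparr>"
  have tr: "is_algebra S B'" "embedding S B' B e" "e ` elts B' = ?C"
    unfolding B'_def by (rule algebra_transport[where e = e and r = r, OF B sub]; (rule cl er; assumption))+
  have "v ` V \<subseteq> e ` elts B'"
    unfolding tr(3)
  proof
    fix b assume "b \<in> v ` V"
    then obtain w where "w \<in> V" "b = v w" by auto
    then have "b = val B v (Var w)" "Var w \<in> ?T" by auto
    then show "b \<in> ?C" by (rule image_eqI)
  qed
  moreover have "elts B' \<subseteq> enc ` ?T"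
  proof
    fix c assume "c \<in> elts B'"
    then obtain b where b: "b \<in> ?C" "c = r b" unfolding B'_def by auto
    show "c \<in> enc ` ?T" unfolding b(2) r_def by (rule imageI) (use s[OF b(1)] in simp)
  qed
  ultimately show thesis by (rule that[OF tr(1,2)])
qed

lemma compatible_universal:
  fixes B :: "('f, 'b) algebra" and X :: "('f, 'a) algebra set"
  assumes E: "quasi_identities S E" and B: "B \<in> models S E"
    and X: "\<And>A. A \<in> X \<Longrightarrow> is_algebra S A" "\<And>A. A \<in> X \<Longrightarrow> \<exists>h. embedding S A B h"
  shows "compatible S E X"
proof -
  obtain h where h: "\<And>A. A \<in> X \<Longrightarrow> embedding S A B (h A)" using X(2) by metis
  let ?V = "SIGMA A : X. elts A"
  have v: "(\<lambda>(A, a). h A a) \<in> ?V \<rightarrow> elts B" using h unfolding embedding_def alg_hom_def by fastforce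
  have alg: "is_algebra S B" using B by (simp add: models_def)
  obtain B' :: "('f, ('f, ('f, 'a) algebra \<times> 'a) trm) algebra" and e
    where B': "is_algebra S B'" "embedding S B' B e" "(\<lambda>(A, a). h A a) ` ?V \<subseteq> e ` elts B'"
    by (rule generated_subalgebra[OF alg v inj_on_id])
  have "\<exists>g. embedding S A B' g" if A: "A \<in> X" for A
  proof -
    let ?g = "\<lambda>a. inv_into (elts B') e (h A a)"
    have im: "h A a \<in> e ` elts B'" if "a \<in> elts A" for a
      by (rule subsetD[OF B'(3)], rule image_eqI[of _ _ "(A, a)"]) (use that A in auto)
    have eg: "e (?g a) = h A a" and g: "?g a \<in> elts B'" if "a \<in> elts A" for a
      using f_inv_into_f[OF im[OF that]] inv_into_into[OF im[OF that]] by simp_all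
    have inje: "inj_on e (elts B')" and he: "alg_hom S B' B e"
      using B'(2) by (auto simp: embedding_def)
    have hA: "alg_hom S A B (h A)" "inj_on (h A) (elts A)" using h[OF A] by (auto simp: embedding_def)
    have "?g (op_on A f xs) = op_on B' f (map ?g xs)"
      if f: "f \<in> syms S" "length xs = arity S f" "set xs \<subseteq> elts A" for f xs
    proof (rule inj_onD[OF inje])
      have o: "op_on A f xs \<in> elts A" using X(1)[OF A] f by (auto simp: is_algebra_def)
      have gs: "set (map ?g xs) \<subseteq> elts B'" using g f(3) by auto
      have 1: "e (?g (op_on A f xs)) = op_on B f (map (h A) xs)"
        using eg[OF o] alg_homD[OF hA(1) f] by simp
      have 2: "map e (map ?g xs) = map (h A) xs"
        unfolding map_map by (rule map_cong[OF refl]) (use eg f(3) in \<open>simp add: subset_iff\<close>)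
      have "length (map ?g xs) = arity S f" using f(2) by simp
      note 3 = alg_homD[OF he f(1) this gs] and 4 = is_algebraD[OF B'(1) f(1) this gs]
      show "e (?g (op_on A f xs)) = e (op_on B' f (map ?g xs))" unfolding 1 3 2 ..
      show "op_on B' f (map ?g xs) \<in> elts B'" using 4 .
      show "?g (op_on A f xs) \<in> elts B'" using g[OF o] .
    qed
    moreover have "inj_on ?g (elts A)"
    proof (rule inj_onI)
      fix a b assume ab: "a \<in> elts A" "b \<in> elts A" "?g a = ?g b"
      have "h A a = h A b" using arg_cong[OF ab(3), of e] unfolding eg[OF ab(1)] eg[OF ab(2)] .
      then show "a = b" by (rule inj_onD[OF hA(2) _ ab(1,2)])
    qed
    ultimately have "embedding S A B' ?g"
      unfolding embedding_def alg_hom_def by (intro conjI ballI allI impI funcsetI g) blast+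
    then show ?thesis by (rule exI[where x = ?g])
  qed
  then show ?thesis
    unfolding compatible_def using models_embedding[OF B'(1,2) B E] by (intro exI[of _ B'] conjI ballI)
qed

lemma subdirectly_irreducible_universal:
  fixes A :: "('f, 'a) algebra" and B :: "'i \<Rightarrow> ('f, 'b) algebra"
  assumes E: "quasi_identities S E" and si: "subdirectly_irreducible S E A"
    and B: "\<And>i. i \<in> I \<Longrightarrow> B i \<in> models S E"
    and D: "subdirect_product S I B D" and h: "alg_iso S A D h"
  shows "\<exists>i \<in> I. alg_iso S D (B i) (\<lambda>x. x i)"
proof -
  have A: "A \<in> models S E" "is_algebra S A"
    using si by (auto simp: subdirectly_irreducible_def models_def)
  have hh: "alg_hom S A D h" "inj_on h (elts A)" "h ` elts A = elts D"
    using h by (auto simp: alg_iso_def bij_betw_def)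
  have hhom: "h (op_on A f xs) = op_on D f (map h xs)"
    if "f \<in> syms S" "length xs = arity S f" "set xs \<subseteq> elts A" for f xs
    using hh(1) that by (simp add: alg_hom_def)
  have Dsub: "is_algebra S D" "elts D \<subseteq> (\<Pi>\<^sub>E i\<in>I. elts (B i))"
    and Dop: "\<And>f xs. f \<in> syms S \<Longrightarrow> length xs = arity S f \<Longrightarrow> set xs \<subseteq> elts D \<Longrightarrow>
        op_on D f xs = (\<lambda>i\<in>I. op_on (B i) f (map (\<lambda>x. x i) xs))"
    and Dsurj: "\<And>i. i \<in> I \<Longrightarrow> (\<lambda>x. x i) ` elts D = elts (B i)"
    using D unfolding subdirect_product_def subalgebra_def prod_algebra_def by simp_all
  have hA: "h a \<in> (\<Pi>\<^sub>E i\<in>I. elts (B i))" if "a \<in> elts A" for a using that hh(3) Dsub(2) by blast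
  define J where "J = {p. fst p \<in> elts A \<and> snd p \<in> elts A \<and> fst p \<noteq> snd p}"
  have "\<exists>i \<in> I. h (fst p) i \<noteq> h (snd p) i" if "p \<in> J" for p
  proof (rule ccontr)
    assume n: "\<not> ?thesis"
    have ab: "fst p \<in> elts A" "snd p \<in> elts A" "fst p \<noteq> snd p" using that by (simp_all add: J_def)
    have "h (fst p) = h (snd p)" by (rule PiE_ext[OF hA[OF ab(1)] hA[OF ab(2)]]) (use n in blast)
    then show False using inj_onD[OF hh(2) _ ab(1,2)] ab(3) by blast
  qed
  then have "\<forall>p \<in> J. \<exists>i. i \<in> I \<and> h (fst p) i \<noteq> h (snd p) i" by blast
  from bchoice[OF this] obtain j
    where j': "\<forall>p \<in> J. j p \<in> I \<and> h (fst p) (j p) \<noteq> h (snd p) (j p)" ..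
  have j: "j p \<in> I" "h (fst p) (j p) \<noteq> h (snd p) (j p)" if "p \<in> J" for p
    using j' that by blast+
  define pr where "pr p a = h a (j p)" for p a
  define r where "r p = inv_into (elts A) (pr p)" for p
  define B' where "B' p = \<lparr>elts = r p ` elts (B (j p)),
      op_on = (\<lambda>f ts. r p (op_on (B (j p)) f (map (pr p) ts)))\<rparr>" for p
  have prs: "pr p ` elts A = elts (B (j p))" if "p \<in> J" for p
    unfolding pr_def Dsurj[OF j(1)[OF that], symmetric] hh(3)[symmetric] image_image ..
  have rA: "r p c \<in> elts A" and rc: "pr p (r p c) = c" if "p \<in> J" "c \<in> elts (B (j p))" for p c
    unfolding r_def prs[OF that(1), symmetric]
    using that(2) unfolding prs[OF that(1), symmetric] by (rule inv_into_into, rule f_inv_into_f)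
  have prhom: "pr p (op_on A f xs) = op_on (B (j p)) f (map (pr p) xs)"
    if "p \<in> J" "f \<in> syms S" "length xs = arity S f" "set xs \<subseteq> elts A" for p f xs
  proof -
    have "set (map h xs) \<subseteq> elts D" using that(4) hh(3) by auto
    then have "h (op_on A f xs) = (\<lambda>i\<in>I. op_on (B i) f (map (\<lambda>x. x i) (map h xs)))"
      using hhom[OF that(2-4)] Dop[OF that(2), of "map h xs"] that(3) by simp
    then show ?thesis using j(1)[OF that(1)] by (simp add: pr_def[abs_def] comp_def)
  qed
  have Balg: "is_algebra S (B (j p))" if "p \<in> J" for p
    using B[OF j(1)[OF that]] by (simp add: models_def)
  have tr: "is_algebra S (B' p)" "embedding S (B' p) (B (j p)) (pr p)"
      "pr p ` elts (B' p) = elts (B (j p))" if "p \<in> J" for p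
    unfolding B'_def
    by (rule algebra_transport[where e = "pr p" and r = "r p", OF Balg[OF that] order_refl];
        (rule is_algebraD[OF Balg[OF that]] rc[OF that]; assumption))+
  have B'm: "B' p \<in> models S E" if "p \<in> J" for p
    by (rule models_embedding[OF tr(1,2)[OF that] B[OF j(1)[OF that]] E])
  define h' where "h' a = (\<lambda>p\<in>J. r p (pr p a))" for a
  define D' where "D' = \<lparr>elts = h' ` elts A, op_on = op_on (prod_algebra J B')\<rparr>"
  have prr: "pr p (r p (pr p a)) = pr p a" if "p \<in> J" "a \<in> elts A" for p a
    by (rule rc[OF that(1)]) (use prs[OF that(1)] that(2) in blast)
  have h'hom: "h' (op_on A f xs) = op_on D' f (map h' xs)"
    if f: "f \<in> syms S" "length xs = arity S f" "set xs \<subseteq> elts A" for f xs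
  proof -
    have "r p (pr p (op_on A f xs)) = op_on (B' p) f (map (\<lambda>x. x p) (map h' xs))"
      if p: "p \<in> J" for p
    proof -
      have "map (pr p) (map (\<lambda>x. x p) (map h' xs)) = map (pr p) xs"
        unfolding map_map
        by (rule map_cong[OF refl]) (use p f(3) prr[OF p] in \<open>auto simp: h'_def\<close>)
      then show ?thesis unfolding prhom[OF p f] B'_def algebra.simps by (simp only:)
    qed
    then show ?thesis
      unfolding D'_def prod_algebra_def h'_def[of "op_on A f xs"] algebra.simps
      by (rule restrict_ext)
  qed
  have h'in: "h' a \<in> (\<Pi>\<^sub>E p\<in>J. elts (B' p))" if "a \<in> elts A" for a
    unfolding h'_def B'_def algebra.simps
  proof (rule restrict_PiE_iff[THEN iffD2], rule ballI)
    fix p assume "p \<in> J"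
    from prs[OF this] that show "r p (pr p a) \<in> r p ` elts (B (j p))" by blast
  qed
  have h'inj: "inj_on h' (elts A)"
  proof (rule inj_onI, rule ccontr)
    fix a b assume ab: "a \<in> elts A" "b \<in> elts A" "h' a = h' b" "a \<noteq> b"
    then have p: "(a, b) \<in> J" by (simp add: J_def)
    have "h' a (a, b) = h' b (a, b)" using ab(3) by simp
    then have "r (a, b) (pr (a, b) a) = r (a, b) (pr (a, b) b)" using p by (simp add: h'_def)
    then have "pr (a, b) a = pr (a, b) b" using prr[OF p ab(1)] prr[OF p ab(2)] by metis
    then show False using j(2)[OF p] by (simp add: pr_def)
  qed
  have D'cl: "op_on D' f xs \<in> elts D'"
    if f: "f \<in> syms S" "length xs = arity S f" "set xs \<subseteq> elts D'" for f xs
  proof -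
    let ?ys = "map (inv_into (elts A) h') xs"
    have ys: "set ?ys \<subseteq> elts A" "map h' ?ys = xs"
    proof -
      have x: "x \<in> h' ` elts A" if "x \<in> set xs" for x using that f(3) by (auto simp: D'_def)
      show "set ?ys \<subseteq> elts A" using inv_into_into[OF x] by auto
      show "map h' ?ys = xs"
        unfolding map_map by (rule map_idI) (use f_inv_into_f[OF x] in simp)
    qed
    have mem: "op_on A f ?ys \<in> elts A" using is_algebraD[OF A(2) f(1) _ ys(1)] f(2) by simp
    have "op_on D' f xs = h' (op_on A f ?ys)"
      using h'hom[OF f(1) _ ys(1)] f(2) unfolding ys(2) by simp
    moreover have "elts D' = h' ` elts A" by (simp add: D'_def)
    ultimately show ?thesis using mem by (metis imageI)
  qed
  have "subdirect_product S J B' D'"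
    unfolding subdirect_product_def subalgebra_def
  proof (intro conjI ballI allI impI)
    show "is_algebra S D'" using D'cl by (simp add: is_algebra_def)
    show "elts D' \<subseteq> elts (prod_algebra J B')" using h'in by (simp add: D'_def prod_algebra_def image_subset_iff)
    show "op_on D' f xs = op_on (prod_algebra J B') f xs" for f xs by (simp add: D'_def)
    fix p assume p: "p \<in> J"
    have "(\<lambda>x. x p) ` elts D' = (\<lambda>a. r p (pr p a)) ` elts A"
      using p by (simp add: D'_def h'_def image_image)
    then show "(\<lambda>x. x p) ` elts D' = elts (B' p)"
      unfolding B'_def algebra.simps prs[OF p, symmetric] image_image .
  qed
  moreover have "alg_iso S A D' h'"
    using h'hom h'inj unfolding alg_iso_def alg_hom_def bij_betw_def by (simp add: D'_def)
  ultimately obtain p where p: "p \<in> J" "alg_iso S D' (B' p) (\<lambda>x. x p)"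
    using si[unfolded subdirectly_irreducible_def, THEN conjunct2, rule_format, of J B' D' h'] B'm
    by blast
  have inj: "a = b" if "a \<in> elts A" "b \<in> elts A" "pr p a = pr p b" for a b
  proof -
    have "h' a p = h' b p" using p(1) that(3) by (simp add: h'_def)
    moreover have "h' a \<in> elts D'" "h' b \<in> elts D'" using that by (simp_all add: D'_def)
    moreover have "inj_on (\<lambda>x. x p) (elts D')" using p(2) by (simp add: alg_iso_def bij_betw_def)
    ultimately have "h' a = h' b" by (simp add: inj_on_def)
    then show ?thesis by (rule inj_onD[OF h'inj _ that(1,2)])
  qed
  have "inj_on (\<lambda>x. x (j p)) (elts D)"
    using inj unfolding hh(3)[symmetric] by (auto simp: inj_on_def pr_def)
  moreover have "alg_hom S D (B (j p)) (\<lambda>x. x (j p))"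
    using Dop Dsurj[OF j(1)[OF p(1)]] j(1)[OF p(1)] unfolding alg_hom_def by auto
  ultimately have "alg_iso S D (B (j p)) (\<lambda>x. x (j p))"
    using Dsurj[OF j(1)[OF p(1)]] by (simp add: alg_iso_def bij_betw_def)
  then show ?thesis using j(1)[OF p(1)] by blast
qed

fun trm_code :: "('v \<Rightarrow> ('f, nat) trm) \<Rightarrow> ('f, 'v) trm \<Rightarrow> ('f, nat) trm" where
  "trm_code g (Var v) = App undefined [Var 0, g v]"
| "trm_code g (App f ts) = App f (Var 1 # map (trm_code g) ts)"

lemma inj_on_trm_code:
  assumes "inj_on g V"
  shows "inj_on (trm_code g) {t. wf_trm S V t}"
proof -
  have "t = u" if "wf_trm S V t" "wf_trm S V u" "trm_code g t = trm_code g u" for t u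
    using that
  proof (induction t arbitrary: u)
    case (Var x) then show ?case using assms by (cases u) (auto dest: inj_onD)
  next
    case (App f ts)
    then obtain us where u: "u = App f us" by (cases u) auto
    have "length ts = length us" using App.prems u by (auto dest: map_eq_imp_length_eq)
    moreover have "ts ! i = us ! i" if i: "i < length ts" for i
    proof (rule App.IH)
      show "ts ! i \<in> set ts" "wf_trm S V (ts ! i)" using i App.prems by auto
      show "wf_trm S V (us ! i)" using i calculation App.prems u by auto
      have "map (trm_code g) ts = map (trm_code g) us" using App.prems u by simp
      then show "trm_code g (ts ! i) = trm_code g (us ! i)" using i calculation by (metis nth_map)
    qed
    ultimately show ?case using u by (simp add: list_eq_iff_nth_eq)
  qed
  then show ?thesis by (auto intro: inj_onI)
qed

fun qi_code :: "'f quasi_identity \<Rightarrow> ('f, nat) trm" where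
  "qi_code (QI I ps (c, d)) =
     App undefined (c # d # App undefined (map Var (sorted_list_of_set I)) #
       map (\<lambda>(a, b). App undefined [a, b]) ps)"

lemma inj_on_qi_code: "inj_on qi_code {q. wf_qi S q}"
proof (rule inj_onI)
  fix p q assume a: "p \<in> {q. wf_qi S q}" "q \<in> {q. wf_qi S q}" "qi_code p = qi_code q"
  obtain I ps c d where p: "p = QI I ps (c, d)" by (metis qi_code.cases)
  obtain J qs c' d' where q: "q = QI J qs (c', d')" by (metis qi_code.cases)
  have "inj (\<lambda>(a, b). App undefined [a, b])" "inj Var" by (auto simp: inj_def)
  then have "ps = qs" "sorted_list_of_set I = sorted_list_of_set J"
    using a(3) unfolding p q by (auto dest: map_injective)
  then show "p = q" using a p q by (auto dest: sorted_list_of_set_inject)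
qed

lemma val_cong:
  assumes "wf_trm S V t" "\<And>w. w \<in> V \<Longrightarrow> x w = y w"
  shows "val A x t = val A y t"
  using assms(1)
proof (induction t)
  case (Var w) then show ?case using assms(2) by simp
next
  case (App f ts)
  then have "map (val A x) ts = map (val A y) ts" by simp
  then show ?case by (simp del: map_eq_conv)
qed

fun qi_vars :: "'f quasi_identity \<Rightarrow> nat set" where
  "qi_vars (QI I ps (c, d)) = I"

fun falsifies :: "('f, 'a) algebra \<Rightarrow> (nat \<Rightarrow> 'a) \<Rightarrow> 'f quasi_identity \<Rightarrow> bool" where
  "falsifies A x (QI I ps (c, d)) \<longleftrightarrow>
     x \<in> I \<rightarrow> elts A \<and> (\<forall>(a, b) \<in> set ps. val A x a = val A x b) \<and> val A x c \<noteq> val A x d"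

lemma not_satisfies_iff: "\<not> satisfies A q \<longleftrightarrow> (\<exists>x. falsifies A x q)"
  by (cases q rule: qi_code.cases) auto

lemma small_equivalent_algebra:
  fixes A :: "('f, 'a) algebra"
  assumes A: "is_algebra S A"
  obtains A' :: "('f, ('f, nat) trm) algebra"
  where "is_algebra S A'" "\<And>q. wf_qi S q \<Longrightarrow> satisfies A' q \<longleftrightarrow> satisfies A q"
proof -
  define Q where "Q = {q. wf_qi S q \<and> \<not> satisfies A q}"
  have "\<forall>q \<in> Q. \<exists>x. falsifies A x q" by (simp add: Q_def not_satisfies_iff)
  from bchoice[OF this] obtain x where x: "\<forall>q \<in> Q. falsifies A (x q) q" ..
  define V where "V = (SIGMA q : Q. qi_vars q)"
  have x_in: "x q n \<in> elts A" if "q \<in> Q" "n \<in> qi_vars q" for q n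
    using bspec[OF x that(1)] that(2) by (cases q rule: qi_code.cases) auto
  have v: "(\<lambda>p. x (fst p) (snd p)) \<in> V \<rightarrow> elts A"
  proof (rule funcsetI)
    fix p assume "p \<in> V"
    then show "x (fst p) (snd p) \<in> elts A" by (intro x_in) (auto simp: V_def)
  qed
  define g :: "'f quasi_identity \<times> nat \<Rightarrow> ('f, nat) trm"
    where "g p = App undefined [Var (snd p), qi_code (fst p)]" for p
  have "inj_on g V"
  proof (rule inj_onI)
    fix p p' assume p: "p \<in> V" "p' \<in> V" "g p = g p'"
    then have "fst p = fst p'"
      by (intro inj_onD[OF inj_on_qi_code[of S]]) (auto simp: V_def Q_def g_def)
    then show "p = p'" using p(3) by (simp add: g_def prod_eq_iff)
  qed
  note inj_on_trm_code[OF this]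
  from generated_subalgebra[OF A v this]
  obtain A' :: "('f, ('f, nat) trm) algebra" and e
    where A': "is_algebra S A'" "embedding S A' A e"
      and im: "(\<lambda>p. x (fst p) (snd p)) ` V \<subseteq> e ` elts A'" .
  have eh: "alg_hom S A' A e" and ei: "inj_on e (elts A')" using A'(2) by (simp_all add: embedding_def)
  have "\<not> satisfies A' q" if q: "wf_qi S q" "\<not> satisfies A q" for q
  proof (cases q rule: qi_code.cases)
    case (1 I ps c d)
    have qQ: "q \<in> Q" using q by (simp add: Q_def)
    define y where "y n = inv_into (elts A') e (x q n)" for n
    have n: "x q n \<in> e ` elts A'" if "n \<in> I" for n
      by (rule subsetD[OF im], rule image_eqI[of _ _ "(q, n)"]) (use that qQ 1 in \<open>simp_all add: V_def\<close>)
    have y: "y \<in> I \<rightarrow> elts A'" unfolding y_def using n by (intro funcsetI inv_into_into)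
    have ey: "(e \<circ> y) n = x q n" if "n \<in> I" for n
      unfolding y_def comp_def by (rule f_inv_into_f[OF n[OF that]])
    have val: "e (val A' y t) = val A (x q) t" if "wf_trm S I t" for t
      unfolding val_hom[OF A'(1) eh that y] by (rule val_cong[OF that ey])
    have inj: "val A' y t = val A' y u \<longleftrightarrow> val A (x q) t = val A (x q) u"
      if "wf_trm S I t" "wf_trm S I u" for t u
      unfolding val[OF that(1), symmetric] val[OF that(2), symmetric]
      by (rule inj_on_eq_iff[OF ei, symmetric]) (intro val_wf_in[OF A'(1) _ y] that)+
    have wf: "wf_trm S I c" "wf_trm S I d"
      "\<And>a b. (a, b) \<in> set ps \<Longrightarrow> wf_trm S I a \<and> wf_trm S I b"
      using q(1) 1 by auto
    have f: "falsifies A (x q) (QI I ps (c, d))" using x qQ unfolding 1 by blast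
    have "val A' y a = val A' y b" if "(a, b) \<in> set ps" for a b
      using f that inj[of a b] wf(3)[OF that] by auto
    moreover have "val A' y c \<noteq> val A' y d" using f inj[OF wf(1,2)] by auto
    ultimately have "falsifies A' y q" using y unfolding 1 by auto
    then show ?thesis unfolding not_satisfies_iff by blast
  qed
  then show thesis using that[OF A'(1)] satisfies_embedding[OF A'] by blast
qed

lemma quasivariety_le_universal:
  assumes le: "quasivariety_le S E E'"
    and E: "quasi_identities S E" and E': "quasi_identities S E'"
  shows "(models S E :: ('f, 'a) algebra set) \<subseteq> models S E'"
proof
  fix A :: "('f, 'a) algebra" assume A: "A \<in> models S E"
  then have alg: "is_algebra S A" by (simp add: models_def)
  obtain A' :: "('f, ('f, nat) trm) algebra"
    where A': "is_algebra S A'" "\<And>q. wf_qi S q \<Longrightarrow> satisfies A' q \<longleftrightarrow> satisfies A q"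
    using small_equivalent_algebra[OF alg] by blast
  have "A' \<in> models S E" using A A' E by (auto simp: models_def quasi_identities_def)
  then have "A' \<in> models S E'" using le by (auto simp: quasivariety_le_def)
  then show "A \<in> models S E'" using alg A' E' by (auto simp: models_def quasi_identities_def)
qed

lemma generated_by_at_most_universal:
  fixes G :: "('f, 'a) algebra set"
  assumes E: "quasi_identities S E" and card: "|G| \<le>o \<kappa>" and G: "generated_by S E G"
  shows "generated_by_at_most S E \<kappa>"
proof -
  have GE: "A \<in> models S E" if "A \<in> G" for A using that G by (auto simp: generated_by_def)
  have "\<exists>A' :: ('f, ('f, nat) trm) algebra.
      is_algebra S A' \<and> (\<forall>q. wf_qi S q \<longrightarrow> satisfies A' q = satisfies A q)" if "A \<in> G" for A
    using small_equivalent_algebra[of S A] GE[OF that] unfolding models_def by blast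
  then obtain s :: "('f, 'a) algebra \<Rightarrow> ('f, ('f, nat) trm) algebra"
    where s: "\<And>A. A \<in> G \<Longrightarrow> is_algebra S (s A)"
      "\<And>A q. A \<in> G \<Longrightarrow> wf_qi S q \<Longrightarrow> satisfies (s A) q = satisfies A q"
    by metis
  have m: "s A \<in> models S E' \<longleftrightarrow> A \<in> models S E'" if "A \<in> G" "quasi_identities S E'" for A E'
    using that s GE by (auto simp: models_def quasi_identities_def)
  have "generated_by S E (s ` G)"
    using G m E unfolding generated_by_def by (simp add: image_subset_iff subset_iff) blast
  moreover have "|s ` G| \<le>o \<kappa>" using card_of_image card ordLeq_transitive by blast
  ultimately show ?thesis unfolding generated_by_at_most_def by blast
qed

end

(* (1) ==> (2): a quasi-identity that fails in P fails in a finitely generated member, and by Zorn's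
   lemma in a subdirectly irreducible quotient of it, so algebras witnessing the compatibility of
   the X_alpha generate P.

   (2) ==> (1): if A is subdirectly irreducible, some pair u, v is identified by every nontrivial
   relative congruence. So any finite part of the diagram of A, inequations included, follows from
   finitely many equations and u ~= v, and holds in some generator. As there are finitely many
   generators, one serves for all finite parts, and the members of P assigned to the same generator
   are jointly embeddable by compactness.

   Failure for infinite kappa: for a set s of unary operation symbols, taken from kappa, let the
   symbols in s act on a two-element algebra as the identity and the others as the transposition.
   The kappa many algebras with s finite generate all of them, but two algebras with different s are
   not compatible, and there are more than kappa of these. *)

theory Submission
  imports Defs
begin

section \<open>Relative congruences and quotients\<close>

lemma quasi_identitiesD:
  assumes "quasi_identities S E" "QI I ps (c, d) \<in> E"
  shows "wf_trm S I c" "wf_trm S I d" "(a, b) \<in> set ps \<Longrightarrow> wf_trm S I a \<and> wf_trm S I b"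
proof -
  have "wf_qi S (QI I ps (c, d))" using assms unfolding quasi_identities_def by blast
  then show "wf_trm S I c" "wf_trm S I d"
    "(a, b) \<in> set ps \<Longrightarrow> wf_trm S I a \<and> wf_trm S I b" by auto
qed

text \<open>The last clause closes \<theta> under the quasi-identities in \<open>E\<close>, which is
  what puts the quotient into the quasivariety. These are the relative congruences of quasivariety
  theory.\<close>

definition rel_congruence ::
    "'f signature \<Rightarrow> 'f quasi_identity set \<Rightarrow> ('f, 'a) algebra \<Rightarrow> 'a rel \<Rightarrow> bool" where
  "rel_congruence S E A \<theta> \<longleftrightarrow>
     equiv (elts A) \<theta> \<and>
     (\<forall>f \<in> syms S. \<forall>xs ys. length xs = arity S f \<and> list_all2 (\<lambda>x y. (x, y) \<in> \<theta>) xs ys \<longrightarrow>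
        (op_on A f xs, op_on A f ys) \<in> \<theta>) \<and>
     (\<forall>I ps c d x. QI I ps (c, d) \<in> E \<and> x \<in> I \<rightarrow> elts A \<and>
        (\<forall>(a, b) \<in> set ps. (val A x a, val A x b) \<in> \<theta>) \<longrightarrow> (val A x c, val A x d) \<in> \<theta>)"

definition rep :: "'a rel \<Rightarrow> 'a \<Rightarrow> 'a" where
  "rep \<theta> x = (SOME y. (x, y) \<in> \<theta>)"

(* The quotient lives on a set of representatives, so that it keeps the carrier type. *)
definition quot :: "('f, 'a) algebra \<Rightarrow> 'a rel \<Rightarrow> ('f, 'a) algebra" where
  "quot A \<theta> = \<lparr>elts = rep \<theta> ` elts A, op_on = (\<lambda>f xs. rep \<theta> (op_on A f xs))\<rparr>"

lemma rel_congruence_opD: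
  assumes "rel_congruence S E A \<theta>" "f \<in> syms S" "length xs = arity S f"
    "list_all2 (\<lambda>x y. (x, y) \<in> \<theta>) xs ys"
  shows "(op_on A f xs, op_on A f ys) \<in> \<theta>"
  using assms unfolding rel_congruence_def by blast

lemma rel_congruence_qiD:
  assumes "rel_congruence S E A \<theta>" "QI I ps (c, d) \<in> E" "x \<in> I \<rightarrow> elts A"
    "\<And>a b. (a, b) \<in> set ps \<Longrightarrow> (val A x a, val A x b) \<in> \<theta>"
  shows "(val A x c, val A x d) \<in> \<theta>"
  using assms unfolding rel_congruence_def by blast

lemma rel_congruence_sub: "rel_congruence S E A \<theta> \<Longrightarrow> \<theta> \<subseteq> elts A \<times> elts A"
  unfolding rel_congruence_def by (auto simp: equiv_def refl_on_def)

lemma rep_rel: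
  assumes "equiv X \<theta>" "x \<in> X"
  shows "(x, rep \<theta> x) \<in> \<theta>"
  unfolding rep_def by (rule someI[of _ x]) (rule equiv_class_self[OF assms, simplified])

lemma rep_in:
  assumes "equiv X \<theta>" "x \<in> X"
  shows "rep \<theta> x \<in> X"
  using rep_rel[OF assms] assms(1) by (auto simp: equiv_def refl_on_def)

lemma rep_eq_iff:
  assumes "equiv X \<theta>" "x \<in> X" "y \<in> X"
  shows "rep \<theta> x = rep \<theta> y \<longleftrightarrow> (x, y) \<in> \<theta>"
proof
  assume "rep \<theta> x = rep \<theta> y"
  then show "(x, y) \<in> \<theta>"
    using rep_rel[OF assms(1,2)] rep_rel[OF assms(1,3)] assms(1)
    by (metis equivE symE transE)
next
  assume xy: "(x, y) \<in> \<theta>"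
  \<comment> \<open>Related elements have the same class, and \<open>SOME\<close> depends only on
    the class.\<close>
  have "(\<lambda>z. (x, z) \<in> \<theta>) = (\<lambda>z. (y, z) \<in> \<theta>)"
    using xy assms(1) by (metis equivE symE transE)
  then show "rep \<theta> x = rep \<theta> y" by (simp add: rep_def)
qed

lemma rep_rep:
  assumes "equiv X \<theta>" "x \<in> X"
  shows "rep \<theta> (rep \<theta> x) = rep \<theta> x"
  using rep_eq_iff[OF assms(1) assms(2) rep_in[OF assms]] rep_rel[OF assms] by simp

text \<open>Replacing arguments by their representatives moves the result only within its class, and
  \<open>rep \<theta>\<close> is constant on each class.\<close>

lemma quot_hom:
  assumes A: "is_algebra S A" and \<theta>: "rel_congruence S E A \<theta>"
  shows "alg_hom S A (quot A \<theta>) (rep \<theta>)"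
  unfolding alg_hom_def
proof (intro conjI ballI allI impI)
  have eq: "equiv (elts A) \<theta>" using \<theta> by (simp add: rel_congruence_def)
  show "rep \<theta> \<in> elts A \<rightarrow> elts (quot A \<theta>)" by (simp add: quot_def)
  fix f xs assume f: "f \<in> syms S" and xs: "length xs = arity S f \<and> set xs \<subseteq> elts A"
  have "list_all2 (\<lambda>x y. (x, y) \<in> \<theta>) xs (map (rep \<theta>) xs)"
    unfolding list_all2_conv_all_nth using xs rep_rel[OF eq]
    by (metis in_mono length_map nth_map nth_mem)
  then have r: "(op_on A f xs, op_on A f (map (rep \<theta>) xs)) \<in> \<theta>"
    using rel_congruence_opD[OF \<theta> f] xs by blast
  then have "op_on A f xs \<in> elts A" "op_on A f (map (rep \<theta>) xs) \<in> elts A"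
    using rel_congruence_sub[OF \<theta>] by auto
  then show "rep \<theta> (op_on A f xs) = op_on (quot A \<theta>) f (map (rep \<theta>) xs)"
    unfolding quot_def using r rep_eq_iff[OF eq] by simp
qed

lemma quot_algebra:
  assumes A: "is_algebra S A" and \<theta>: "rel_congruence S E A \<theta>"
  shows "is_algebra S (quot A \<theta>)"
  unfolding is_algebra_def
proof (intro ballI allI impI)
  have eq: "equiv (elts A) \<theta>" using \<theta> by (simp add: rel_congruence_def)
  fix f xs assume "f \<in> syms S" and xs: "length xs = arity S f \<and> set xs \<subseteq> elts (quot A \<theta>)"
  moreover have "set xs \<subseteq> elts A" using xs rep_in[OF eq] by (auto simp: quot_def)
  ultimately have "op_on A f xs \<in> elts A" using is_algebraD[OF A] by blast
  then show "op_on (quot A \<theta>) f xs \<in> elts (quot A \<theta>)" by (simp add: quot_def)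
qed

text \<open>An assignment into the quotient has representatives as values, so it is also an
  assignment into \<open>A\<close>, fixed by \<open>rep \<theta>\<close>. Equations in the quotient
  thus become memberships in \<theta>, to which closure under \<open>E\<close> applies.\<close>

lemma quot_models:
  assumes A: "is_algebra S A" and E: "quasi_identities S E" and \<theta>: "rel_congruence S E A \<theta>"
  shows "quot A \<theta> \<in> models S E"
proof -
  have eq: "equiv (elts A) \<theta>" using \<theta> by (simp add: rel_congruence_def)
  have "satisfies (quot A \<theta>) q" if q: "q \<in> E" for q
  proof (cases q rule: qi_code.cases)
    case (1 I ps c d)
    note wf = quasi_identitiesD[OF E q[unfolded 1]]
    have "val (quot A \<theta>) x c = val (quot A \<theta>) x d"
      if x: "x \<in> I \<rightarrow> elts (quot A \<theta>)"
        and p: "\<forall>(a, b) \<in> set ps. val (quot A \<theta>) x a = val (quot A \<theta>) x b" for x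
    proof -
      have x': "\<exists>y \<in> elts A. x n = rep \<theta> y" if "n \<in> I" for n
        using funcset_mem[OF x that] by (auto simp: quot_def)
      have xA: "x \<in> I \<rightarrow> elts A" using x' rep_in[OF eq] by (metis funcsetI)
      have xr: "(rep \<theta> \<circ> x) n = x n" if "n \<in> I" for n
        using x'[OF that] rep_rep[OF eq] by auto
      have v: "val (quot A \<theta>) x t = rep \<theta> (val A x t)" if "wf_trm S I t" for t
        using val_hom[OF A quot_hom[OF A \<theta>] that xA] val_cong[where A = "quot A \<theta>", OF that xr] by simp
      have m: "val A x t \<in> elts A" if "wf_trm S I t" for t
        by (rule val_wf_in[OF A that xA])
      have "(val A x a, val A x b) \<in> \<theta>" if ab: "(a, b) \<in> set ps" for a b
      proof -
        have ab': "wf_trm S I a" "wf_trm S I b" using wf(3)[OF ab] by auto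
        have "val (quot A \<theta>) x a = val (quot A \<theta>) x b" using p ab by auto
        then show ?thesis unfolding v[OF ab'(1)] v[OF ab'(2)] rep_eq_iff[OF eq m[OF ab'(1)] m[OF ab'(2)]] .
      qed
      then have "(val A x c, val A x d) \<in> \<theta>"
        using rel_congruence_qiD[OF \<theta> q[unfolded 1] xA] by blast
      then show ?thesis
        unfolding v[OF wf(1)] v[OF wf(2)] rep_eq_iff[OF eq m[OF wf(1)] m[OF wf(2)]] .
    qed
    then show ?thesis unfolding 1 by simp
  qed
  then show ?thesis using quot_algebra[OF A \<theta>] by (simp add: models_def)
qed

definition ker :: "'a set \<Rightarrow> ('a \<Rightarrow> 'b) \<Rightarrow> 'a rel" where
  "ker X h = {(x, y). x \<in> X \<and> y \<in> X \<and> h x = h y}"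

text \<open>A converse to \<open>quot_models\<close>: membership in the kernel is equality of images
  in \<open>B\<close>, so closure under \<open>E\<close> is inherited from \<open>B\<close>.\<close>

lemma rel_congruence_ker:
  assumes A: "is_algebra S A" and h: "alg_hom S A B h" and B: "B \<in> models S E"
    and E: "quasi_identities S E"
  shows "rel_congruence S E A (ker (elts A) h)"
  unfolding rel_congruence_def
proof (intro conjI ballI allI impI)
  show "equiv (elts A) (ker (elts A) h)"
    by (auto simp: ker_def intro!: equivI refl_onI symI transI)
next
  fix f xs ys
  assume f: "f \<in> syms S"
    and "length xs = arity S f \<and> list_all2 (\<lambda>x y. (x, y) \<in> ker (elts A) h) xs ys"
  then have l: "length xs = arity S f" "length ys = arity S f"
    and s: "set xs \<subseteq> elts A" "set ys \<subseteq> elts A" and m: "map h xs = map h ys"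
    by (auto simp: list_all2_conv_all_nth ker_def in_set_conv_nth intro!: nth_equalityI)
  show "(op_on A f xs, op_on A f ys) \<in> ker (elts A) h"
    using is_algebraD[OF A f] alg_homD[OF h f] l s m by (simp add: ker_def)
next
  fix I ps c d x
  assume a: "QI I ps (c, d) \<in> E \<and> x \<in> I \<rightarrow> elts A \<and>
      (\<forall>(a, b) \<in> set ps. (val A x a, val A x b) \<in> ker (elts A) h)"
  then have x: "x \<in> I \<rightarrow> elts A" by blast
  note wf = quasi_identitiesD[OF E conjunct1[OF a]]
  have v: "h (val A x t) = val B (h \<circ> x) t" "val A x t \<in> elts A" if "wf_trm S I t" for t
    using val_hom[OF A h that x] val_wf_in[OF A that x] by simp_all
  have "h \<circ> x \<in> I \<rightarrow> elts B" using x h by (auto simp: alg_hom_def)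
  moreover have "\<forall>(a, b) \<in> set ps. val B (h \<circ> x) a = val B (h \<circ> x) b"
  proof clarify
    fix a' b' assume "(a', b') \<in> set ps"
    then show "val B (h \<circ> x) a' = val B (h \<circ> x) b'"
      using a wf(3) v by (fastforce simp: ker_def)
  qed
  moreover have "satisfies B (QI I ps (c, d))" using a B unfolding models_def by blast
  ultimately have "val B (h \<circ> x) c = val B (h \<circ> x) d" by simp
  then show "(val A x c, val A x d) \<in> ker (elts A) h" using v wf(1,2) by (simp add: ker_def)
qed

lemma rel_congruence_Id_on:
  assumes "A \<in> models S E" "quasi_identities S E"
  shows "rel_congruence S E A (Id_on (elts A))"
proof -
  have "alg_hom S A A (\<lambda>x. x)" by (simp add: alg_hom_def)
  moreover have "ker (elts A) (\<lambda>x. x) = Id_on (elts A)" by (auto simp: ker_def)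
  ultimately show ?thesis using rel_congruence_ker[of S A A "\<lambda>x. x" E] assms
    by (simp add: models_def)
qed

text \<open>This is the kernel of the map to a one-element algebra, which satisfies every
  quasi-identity.\<close>

lemma rel_congruence_full:
  assumes "is_algebra S A" "quasi_identities S E"
  shows "rel_congruence S E A (elts A \<times> elts A)"
proof -
  have "alg_hom S A \<lparr>elts = UNIV, op_on = \<lambda>_ _. ()\<rparr> (\<lambda>_. ())" by (simp add: alg_hom_def)
  moreover have "satisfies \<lparr>elts = UNIV, op_on = \<lambda>_ _. ()\<rparr> q" for q :: "'a quasi_identity"
    by (cases q rule: qi_code.cases) simp
  then have "\<lparr>elts = UNIV, op_on = \<lambda>_ _. ()\<rparr> \<in> models S E"
    by (simp add: models_def is_algebra_def)
  moreover have "ker (elts A) (\<lambda>_. ()) = elts A \<times> elts A" by (auto simp: ker_def)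
  ultimately show ?thesis
    using rel_congruence_ker[of S A "\<lparr>elts = UNIV, op_on = \<lambda>_ _. ()\<rparr>" "\<lambda>_. ()" E] assms by simp
qed

text \<open>Apart from containment in \<open>elts A \<times> elts A\<close>, the conditions are
  closure conditions and pass to intersections. Containment comes from any member of \<Theta>,
  whereas \<open>\<Inter>{}\<close> is \<open>UNIV\<close>.\<close>

lemma rel_congruence_Inter:
  assumes "\<Theta> \<noteq> {}" and \<theta>: "\<And>\<theta>. \<theta> \<in> \<Theta> \<Longrightarrow> rel_congruence S E A \<theta>"
  shows "rel_congruence S E A (\<Inter>\<Theta>)"
  unfolding rel_congruence_def
proof (intro conjI ballI allI impI)
  have "equiv (elts A) \<theta>" if "\<theta> \<in> \<Theta>" for \<theta> using \<theta>[OF that] by (simp add: rel_congruence_def)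
  then have eq: "\<theta> \<subseteq> elts A \<times> elts A" "refl_on (elts A) \<theta>" "sym \<theta>" "trans \<theta>" if "\<theta> \<in> \<Theta>" for \<theta>
    using that by (auto simp: equiv_def)
  show "equiv (elts A) (\<Inter>\<Theta>)"
  proof (rule equivI)
    show "\<Inter>\<Theta> \<subseteq> elts A \<times> elts A" using eq(1) \<open>\<Theta> \<noteq> {}\<close> by blast
    show "refl_on (elts A) (\<Inter>\<Theta>)" using eq(2) by (simp add: refl_on_def)
    show "sym (\<Inter>\<Theta>)" using eq(3) by (auto simp: sym_def)
    show "trans (\<Inter>\<Theta>)" using eq(4) unfolding trans_def by (meson InterE InterI)
  qed
next
  fix f xs ys
  assume f: "f \<in> syms S" and l: "length xs = arity S f \<and> list_all2 (\<lambda>x y. (x, y) \<in> \<Inter>\<Theta>) xs ys"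
  have "list_all2 (\<lambda>x y. (x, y) \<in> \<theta>) xs ys" if "\<theta> \<in> \<Theta>" for \<theta>
    by (rule list_all2_mono[OF conjunct2[OF l]]) (use that in blast)
  then show "(op_on A f xs, op_on A f ys) \<in> \<Inter>\<Theta>" using rel_congruence_opD[OF \<theta> f] l by blast
next
  fix I ps c d x
  assume a: "QI I ps (c, d) \<in> E \<and> x \<in> I \<rightarrow> elts A \<and>
      (\<forall>(a, b) \<in> set ps. (val A x a, val A x b) \<in> \<Inter>\<Theta>)"
  show "(val A x c, val A x d) \<in> \<Inter>\<Theta>"
  proof
    fix \<theta> assume t: "\<theta> \<in> \<Theta>"
    show "(val A x c, val A x d) \<in> \<theta>"
      by (rule rel_congruence_qiD[OF \<theta>[OF t]]) (use a t in auto)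
  qed
qed

section \<open>Directed unions and generated relative congruences\<close>

lemma finite_subset_directed:
  assumes "finite F" "F \<subseteq> \<Union>\<Theta>" "\<Theta> \<noteq> {}"
    and dir: "\<And>\<theta> \<eta>. \<theta> \<in> \<Theta> \<Longrightarrow> \<eta> \<in> \<Theta> \<Longrightarrow> \<exists>\<zeta> \<in> \<Theta>. \<theta> \<union> \<eta> \<subseteq> \<zeta>"
  shows "\<exists>\<theta> \<in> \<Theta>. F \<subseteq> \<theta>"
  using assms(1,2)
proof (induction F rule: finite_induct)
  case empty
  then show ?case using \<open>\<Theta> \<noteq> {}\<close> by auto
next
  case (insert x F)
  then obtain \<theta> \<eta> where t: "\<theta> \<in> \<Theta>" "F \<subseteq> \<theta>" "\<eta> \<in> \<Theta>" "x \<in> \<eta>" by auto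
  with dir[of \<theta> \<eta>] obtain \<zeta> where "\<zeta> \<in> \<Theta>" "\<theta> \<union> \<eta> \<subseteq> \<zeta>" by blast
  then show ?case using t by blast
qed

(* This is where finiteness of the arities and of the premises of quasi-identities enters. *)
lemma rel_congruence_Union:
  assumes "\<Theta> \<noteq> {}" and \<theta>: "\<And>\<theta>. \<theta> \<in> \<Theta> \<Longrightarrow> rel_congruence S E A \<theta>"
    and dir: "\<And>\<theta> \<eta>. \<theta> \<in> \<Theta> \<Longrightarrow> \<eta> \<in> \<Theta> \<Longrightarrow> \<exists>\<zeta> \<in> \<Theta>. \<theta> \<union> \<eta> \<subseteq> \<zeta>"
  shows "rel_congruence S E A (\<Union>\<Theta>)"
  unfolding rel_congruence_def
proof (intro conjI ballI allI impI)
  have eq: "equiv (elts A) \<theta>" if "\<theta> \<in> \<Theta>" for \<theta> using \<theta>[OF that] by (simp add: rel_congruence_def)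
  have "trans (\<Union>\<Theta>)"
  proof (rule transI)
    fix x y z assume "(x, y) \<in> \<Union>\<Theta>" "(y, z) \<in> \<Union>\<Theta>"
    then obtain \<zeta> where "\<zeta> \<in> \<Theta>" "{(x, y), (y, z)} \<subseteq> \<zeta>"
      using finite_subset_directed[of "{(x, y), (y, z)}" \<Theta>] \<open>\<Theta> \<noteq> {}\<close> dir by auto
    moreover from this have "trans \<zeta>" using eq[of \<zeta>] by (simp add: equiv_def)
    ultimately show "(x, z) \<in> \<Union>\<Theta>" by (meson UnionI insert_subset transD)
  qed
  moreover have eq': "\<theta> \<subseteq> elts A \<times> elts A" "refl_on (elts A) \<theta>" "sym \<theta>" if "\<theta> \<in> \<Theta>" for \<theta>
    using eq[OF that] by (auto simp: equiv_def)
  ultimately show "equiv (elts A) (\<Union>\<Theta>)"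
  proof (intro equivI)
    show "\<Union>\<Theta> \<subseteq> elts A \<times> elts A" using eq'(1) by blast
    show "refl_on (elts A) (\<Union>\<Theta>)" using eq'(2) \<open>\<Theta> \<noteq> {}\<close> by (auto simp: refl_on_def)
    show "sym (\<Union>\<Theta>)" using eq'(3) unfolding sym_def by blast
  qed
next
  fix f xs ys
  assume f: "f \<in> syms S" and l: "length xs = arity S f \<and> list_all2 (\<lambda>x y. (x, y) \<in> \<Union>\<Theta>) xs ys"
  then have "set (zip xs ys) \<subseteq> \<Union>\<Theta>" by (auto simp: list_all2_iff)
  then obtain \<theta> where t: "\<theta> \<in> \<Theta>" "set (zip xs ys) \<subseteq> \<theta>"
    using finite_subset_directed[of "set (zip xs ys)" \<Theta>] \<open>\<Theta> \<noteq> {}\<close> dir by auto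
  then have "list_all2 (\<lambda>x y. (x, y) \<in> \<theta>) xs ys" using l by (auto simp: list_all2_iff)
  then show "(op_on A f xs, op_on A f ys) \<in> \<Union>\<Theta>"
    using rel_congruence_opD[OF \<theta>[OF t(1)] f] l t(1) by blast
next
  fix I ps c d x
  assume a: "QI I ps (c, d) \<in> E \<and> x \<in> I \<rightarrow> elts A \<and>
      (\<forall>(a, b) \<in> set ps. (val A x a, val A x b) \<in> \<Union>\<Theta>)"
  let ?F = "(\<lambda>(a, b). (val A x a, val A x b)) ` set ps"
  have "?F \<subseteq> \<Union>\<Theta>" using a by auto
  then obtain \<theta> where t: "\<theta> \<in> \<Theta>" "?F \<subseteq> \<theta>"
    using finite_subset_directed[of ?F \<Theta>] \<open>\<Theta> \<noteq> {}\<close> dir by auto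
  have "(val A x c, val A x d) \<in> \<theta>"
    by (rule rel_congruence_qiD[OF \<theta>[OF t(1)]]) (use a t(2) in auto)
  then show "(val A x c, val A x d) \<in> \<Union>\<Theta>" using t(1) by blast
qed

text \<open>For \<open>R\<close> inside \<open>elts A \<times> elts A\<close> this is the least
  relative congruence containing \<open>R\<close>: by \<open>rel_congruence_full\<close> the
  intersected family is then nonempty.\<close>

definition cg ::
    "'f signature \<Rightarrow> 'f quasi_identity set \<Rightarrow> ('f, 'a) algebra \<Rightarrow> 'a rel \<Rightarrow> 'a rel" where
  "cg S E A R = \<Inter>{\<theta>. rel_congruence S E A \<theta> \<and> R \<subseteq> \<theta>}"

lemma cg_least: "rel_congruence S E A \<theta> \<Longrightarrow> R \<subseteq> \<theta> \<Longrightarrow> cg S E A R \<subseteq> \<theta>"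
  by (auto simp: cg_def)

lemma cg_superset: "R \<subseteq> cg S E A R"
  by (auto simp: cg_def)

lemma cg_mono: "R \<subseteq> R' \<Longrightarrow> cg S E A R \<subseteq> cg S E A R'"
  by (auto simp: cg_def)

lemma rel_congruence_cg:
  assumes "is_algebra S A" "quasi_identities S E" "R \<subseteq> elts A \<times> elts A"
  shows "rel_congruence S E A (cg S E A R)"
  unfolding cg_def
  by (rule rel_congruence_Inter) (use rel_congruence_full[OF assms(1,2)] assms(3) in auto)

text \<open>The relative congruences generated by finite subsets of \<open>R\<close> form a directed
  family. Their union is a relative congruence containing \<open>R\<close>, so it contains
  \<open>cg S E A R\<close>. All later compactness arguments rest on this.\<close>

lemma cg_finitary:
  assumes A: "is_algebra S A" and E: "quasi_identities S E" and R: "R \<subseteq> elts A \<times> elts A"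
    and p: "p \<in> cg S E A R"
  obtains F where "finite F" "F \<subseteq> R" "p \<in> cg S E A F"
proof -
  let ?\<Theta> = "cg S E A ` {F. finite F \<and> F \<subseteq> R}"
  have "rel_congruence S E A (\<Union>?\<Theta>)"
  proof (rule rel_congruence_Union)
    show "?\<Theta> \<noteq> {}" by blast
    show "rel_congruence S E A \<theta>" if "\<theta> \<in> ?\<Theta>" for \<theta>
      using that rel_congruence_cg[OF A E] R by fastforce
    fix \<theta> \<eta> assume "\<theta> \<in> ?\<Theta>" "\<eta> \<in> ?\<Theta>"
    then obtain F G where F: "finite F" "F \<subseteq> R" "finite G" "G \<subseteq> R"
      and eq: "\<theta> = cg S E A F" "\<eta> = cg S E A G" by auto
    have "\<theta> \<union> \<eta> \<subseteq> cg S E A (F \<union> G)" unfolding eq by (intro Un_least cg_mono) auto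
    moreover have "cg S E A (F \<union> G) \<in> ?\<Theta>" by (rule imageI) (use F in simp)
    ultimately show "\<exists>\<zeta> \<in> ?\<Theta>. \<theta> \<union> \<eta> \<subseteq> \<zeta>" by blast
  qed
  moreover have "R \<subseteq> \<Union>?\<Theta>"
  proof
    fix r assume "r \<in> R"
    then have "cg S E A {r} \<in> ?\<Theta>" by (intro imageI) simp
    moreover have "r \<in> cg S E A {r}" using cg_superset[of "{r}"] by simp
    ultimately show "r \<in> \<Union>?\<Theta>" by (rule UnionI)
  qed
  ultimately have "cg S E A R \<subseteq> \<Union>?\<Theta>" by (rule cg_least)
  then have "p \<in> \<Union>?\<Theta>" using p by (rule subsetD)
  then show thesis using that by auto
qed


section \<open>Subdirectly irreducible algebras\<close>

lemma subdirect_product_ops: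
  assumes "subdirect_product S I B D" "f \<in> syms S" "length xs = arity S f" "set xs \<subseteq> elts D"
    "i \<in> I"
  shows "op_on D f xs i = op_on (B i) f (map (\<lambda>x. x i) xs)"
  using assms by (simp add: subdirect_product_def subalgebra_def prod_algebra_def)

lemma subdirect_product_proj_hom:
  assumes "subdirect_product S I B D" "i \<in> I"
  shows "alg_hom S D (B i) (\<lambda>x. x i)"
  using assms subdirect_product_ops[OF assms(1) _ _ _ assms(2)]
  unfolding alg_hom_def subdirect_product_def by blast

lemma subdirect_product_proj_iso:
  assumes "subdirect_product S I B D" "i \<in> I" "inj_on (\<lambda>x. x i) (elts D)"
  shows "alg_iso S D (B i) (\<lambda>x. x i)"
  using assms subdirect_product_proj_hom[OF assms(1,2)]
  by (simp add: alg_iso_def bij_betw_def subdirect_product_def)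

text \<open>Elements of the product are extensional functions, so agreement on \<open>I\<close> is
  equality.\<close>

lemma subdirect_product_eqI:
  assumes "subdirect_product S I B D" "x \<in> elts D" "y \<in> elts D" "\<And>i. i \<in> I \<Longrightarrow> x i = y i"
  shows "x = y"
proof (rule PiE_ext)
  show "x \<in> (\<Pi>\<^sub>E i\<in>I. elts (B i))" "y \<in> (\<Pi>\<^sub>E i\<in>I. elts (B i))"
    using assms(1-3) by (auto simp: subdirect_product_def subalgebra_def prod_algebra_def)
qed (rule assms(4))

lemma alg_hom_comp:
  assumes g: "alg_hom S A B g" and h: "alg_hom S B C h"
  shows "alg_hom S A C (\<lambda>x. h (g x))"
  unfolding alg_hom_def
proof (intro conjI ballI allI impI)
  show "(\<lambda>x. h (g x)) \<in> elts A \<rightarrow> elts C" using g h by (auto simp: alg_hom_def)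
  fix f xs assume f: "f \<in> syms S" and xs: "length xs = arity S f \<and> set xs \<subseteq> elts A"
  have "set (map g xs) \<subseteq> elts B" using xs g by (auto simp: alg_hom_def)
  then show "h (g (op_on A f xs)) = op_on C f (map (\<lambda>x. h (g x)) xs)"
    using alg_homD[OF g f] alg_homD[OF h f, of "map g xs"] xs by (simp add: comp_def)
qed

text \<open>In a subdirect decomposition some projection separates the images of \<open>u\<close>
  and \<open>v\<close>. Pulled back to \<open>A\<close>, its kernel is a relative congruence above
  \<theta> that omits \<open>(u, v)\<close>. By maximality it is \<theta>, so this projection is
  injective.\<close>

lemma quot_subdirectly_irreducible:
  fixes A :: "('f, 'a) algebra"
  assumes A: "is_algebra S A" and E: "quasi_identities S E" and \<theta>: "rel_congruence S E A \<theta>"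
    and uv: "u \<in> elts A" "v \<in> elts A" "(u, v) \<notin> \<theta>"
    and max: "\<And>\<eta>. rel_congruence S E A \<eta> \<Longrightarrow> \<theta> \<subseteq> \<eta> \<Longrightarrow> (u, v) \<notin> \<eta> \<Longrightarrow> \<eta> = \<theta>"
  shows "subdirectly_irreducible S E (quot A \<theta>)"
  unfolding subdirectly_irreducible_def
proof (intro conjI allI impI)
  let ?Q = "quot A \<theta>"
  have eq: "equiv (elts A) \<theta>" using \<theta> by (simp add: rel_congruence_def)
  show "?Q \<in> models S E" by (rule quot_models[OF A E \<theta>])
  fix I :: "('a \<times> 'a) set" and B :: "'a \<times> 'a \<Rightarrow> ('f, 'a) algebra" and D h
  assume "(\<forall>i \<in> I. B i \<in> models S E) \<and> subdirect_product S I B D \<and> alg_iso S ?Q D h"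
  then have B: "\<And>i. i \<in> I \<Longrightarrow> B i \<in> models S E" and D: "subdirect_product S I B D"
    and h: "alg_hom S ?Q D h" "bij_betw h (elts ?Q) (elts D)" by (auto simp: alg_iso_def)
  define g where "g x = h (rep \<theta> x)" for x
  have g: "alg_hom S A D g" unfolding g_def by (rule alg_hom_comp[OF quot_hom[OF A \<theta>] h(1)])
  have gD: "g x \<in> elts D" if "x \<in> elts A" for x using g that by (auto simp: alg_hom_def)
  have g_eq: "g x = g y \<longleftrightarrow> (x, y) \<in> \<theta>" if "x \<in> elts A" "y \<in> elts A" for x y
    using h(2) that rep_eq_iff[OF eq that]
    by (auto simp: g_def bij_betw_def quot_def dest: inj_onD)
  have "g u \<noteq> g v" using g_eq uv by simp
  then obtain i where i: "i \<in> I" "g u i \<noteq> g v i"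
    using subdirect_product_eqI[OF D gD[OF uv(1)] gD[OF uv(2)]] by blast
  let ?k = "ker (elts A) (\<lambda>x. g x i)"
  have "rel_congruence S E A ?k"
    by (rule rel_congruence_ker[OF A alg_hom_comp[OF g subdirect_product_proj_hom[OF D i(1)]]
          B[OF i(1)] E])
  moreover have "\<theta> \<subseteq> ?k"
  proof clarify
    fix x y assume xy: "(x, y) \<in> \<theta>"
    then have "x \<in> elts A" "y \<in> elts A" using rel_congruence_sub[OF \<theta>] by auto
    then show "(x, y) \<in> ?k" using g_eq[of x y] xy by (simp add: ker_def)
  qed
  ultimately have k: "?k = \<theta>" using max i(2) by (auto simp: ker_def)
  have im: "elts D = g ` elts A"
    using h(2) by (auto simp: bij_betw_def quot_def g_def image_image)
  have "inj_on (\<lambda>x. x i) (elts D)"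
  proof (rule inj_onI)
    fix a b assume "a \<in> elts D" "b \<in> elts D" and ab: "a i = b i"
    then obtain x y where x: "x \<in> elts A" "y \<in> elts A" "a = g x" "b = g y" using im by auto
    then have "(x, y) \<in> \<theta>" using ab k by (auto simp: ker_def)
    then show "a = b" using g_eq x by simp
  qed
  then show "\<exists>i \<in> I. alg_iso S D (B i) (\<lambda>x. x i)" using subdirect_product_proj_iso[OF D i(1)] i(1) by blast
qed

text \<open>Zorn's lemma gives a maximal relative congruence omitting \<open>(u, v)\<close>; the
  identity shows that there is one to start from. The quotient by it is the required
  algebra.\<close>

lemma separating_subdirectly_irreducible:
  fixes A :: "('f, 'a) algebra"
  assumes A: "A \<in> models S E" and E: "quasi_identities S E"
    and uv: "u \<in> elts A" "v \<in> elts A" "u \<noteq> v"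
  obtains B :: "('f, 'a) algebra" and h
  where "subdirectly_irreducible S E B" "alg_hom S A B h" "h u \<noteq> h v"
proof -
  have alg: "is_algebra S A" using A by (simp add: models_def)
  let ?F = "{\<theta>. rel_congruence S E A \<theta> \<and> (u, v) \<notin> \<theta>}"
  have "\<exists>\<theta> \<in> ?F. \<forall>\<eta> \<in> ?F. \<theta> \<subseteq> \<eta> \<longrightarrow> \<eta> = \<theta>"
  proof (rule subset_Zorn_nonempty)
    show "?F \<noteq> {}" using rel_congruence_Id_on[OF A E] uv(3) by auto
    fix \<C> assume C: "\<C> \<noteq> {}" "subset.chain ?F \<C>"
    have "rel_congruence S E A (\<Union>\<C>)"
    proof (rule rel_congruence_Union[OF C(1)])
      show "rel_congruence S E A \<theta>" if "\<theta> \<in> \<C>" for \<theta> using that C(2) by (auto simp: subset_chain_def)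
      fix \<theta> \<eta> assume "\<theta> \<in> \<C>" "\<eta> \<in> \<C>"
      moreover from this have "\<theta> \<subseteq> \<eta> \<or> \<eta> \<subseteq> \<theta>" using C(2) by (auto simp: subset_chain_def)
      ultimately show "\<exists>\<zeta> \<in> \<C>. \<theta> \<union> \<eta> \<subseteq> \<zeta>" by (metis Un_least order_refl)
    qed
    then show "\<Union>\<C> \<in> ?F" using C(2) by (auto simp: subset_chain_def)
  qed
  then obtain \<theta> where \<theta>: "rel_congruence S E A \<theta>" "(u, v) \<notin> \<theta>"
    and max: "\<And>\<eta>. rel_congruence S E A \<eta> \<Longrightarrow> \<theta> \<subseteq> \<eta> \<Longrightarrow> (u, v) \<notin> \<eta> \<Longrightarrow> \<eta> = \<theta>" by blast
  have "equiv (elts A) \<theta>" using \<theta> by (simp add: rel_congruence_def)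
  then have "rep \<theta> u \<noteq> rep \<theta> v" using rep_eq_iff uv \<theta>(2) by metis
  then show thesis
    using that quot_subdirectly_irreducible[OF alg E \<theta>(1) uv(1,2) \<theta>(2) max] quot_hom[OF alg \<theta>(1)]
    by blast
qed

text \<open>Otherwise each pair of distinct elements is omitted by some nontrivial relative
  congruence. The quotients by these give a subdirect decomposition without an injective projection.
  If \<open>A\<close> has at most one element, this is the decomposition with the empty
  family.\<close>

lemma subdirectly_irreducible_monolith:
  fixes A :: "('f, 'a) algebra"
  assumes si: "subdirectly_irreducible S E A" and E: "quasi_identities S E"
  obtains u v where "u \<in> elts A" "v \<in> elts A" "u \<noteq> v"
    "\<And>\<theta>. rel_congruence S E A \<theta> \<Longrightarrow> (u, v) \<notin> \<theta> \<Longrightarrow> \<theta> \<subseteq> Id"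
proof (rule ccontr)
  assume no: "\<not> thesis"
  have A: "is_algebra S A" using si by (simp add: subdirectly_irreducible_def models_def)
  \<comment> \<open>Indexing by pairs, together with quotients on representatives, fits the index
    and carrier types in \<open>subdirectly_irreducible\<close>.\<close>
  define I where "I = {p. fst p \<in> elts A \<and> snd p \<in> elts A \<and> fst p \<noteq> snd p}"
  have "\<forall>p \<in> I. \<exists>\<theta>. rel_congruence S E A \<theta> \<and> p \<notin> \<theta> \<and> \<not> \<theta> \<subseteq> Id"
  proof
    fix p assume "p \<in> I"
    then have p: "fst p \<in> elts A" "snd p \<in> elts A" "fst p \<noteq> snd p" by (auto simp: I_def)
    have "\<not> (\<forall>\<theta>. rel_congruence S E A \<theta> \<longrightarrow> (fst p, snd p) \<notin> \<theta> \<longrightarrow> \<theta> \<subseteq> Id)"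
      using no that[OF p] by blast
    then show "\<exists>\<theta>. rel_congruence S E A \<theta> \<and> p \<notin> \<theta> \<and> \<not> \<theta> \<subseteq> Id" by simp
  qed
  from bchoice[OF this] obtain \<Theta> where
    \<Theta>: "\<And>p. p \<in> I \<Longrightarrow> rel_congruence S E A (\<Theta> p)" "\<And>p. p \<in> I \<Longrightarrow> p \<notin> \<Theta> p"
      "\<And>p. p \<in> I \<Longrightarrow> \<not> \<Theta> p \<subseteq> Id" by blast
  have eq: "equiv (elts A) (\<Theta> p)" if "p \<in> I" for p using \<Theta>(1)[OF that] by (simp add: rel_congruence_def)
  define B where "B p = quot A (\<Theta> p)" for p
  define h where "h a = (\<lambda>p\<in>I. rep (\<Theta> p) a)" for a
  define D where "D = \<lparr>elts = h ` elts A, op_on = op_on (prod_algebra I B)\<rparr>"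
  have hin: "h ` elts A \<subseteq> elts (prod_algebra I B)"
    by (auto simp: h_def prod_algebra_def B_def quot_def)
  have hop: "h (op_on A f xs) = op_on D f (map h xs)"
    if f: "f \<in> syms S" "length xs = arity S f" "set xs \<subseteq> elts A" for f xs
  proof -
    have "rep (\<Theta> p) (op_on A f xs) = op_on (B p) f (map (\<lambda>x. x p) (map h xs))" if p: "p \<in> I" for p
    proof -
      have "map (\<lambda>x. x p) (map h xs) = map (rep (\<Theta> p)) xs" using p by (simp add: h_def)
      then show ?thesis
        using alg_homD[OF quot_hom[OF A \<Theta>(1)[OF p]] f] unfolding B_def by (simp only:)
    qed
    then show ?thesis
      unfolding D_def prod_algebra_def h_def[of "op_on A f xs"] algebra.simps by (rule restrict_ext)
  qed
  have Dalg: "is_algebra S D"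
    unfolding is_algebra_def
  proof (intro ballI allI impI)
    fix f xs assume f: "f \<in> syms S" and xs: "length xs = arity S f \<and> set xs \<subseteq> elts D"
    then have "xs \<in> lists (h ` elts A)" by (auto simp: D_def)
    then obtain ys where ys: "xs = map h ys" "set ys \<subseteq> elts A" unfolding lists_image by auto
    have "op_on D f xs = h (op_on A f ys)" using hop[OF f _ ys(2)] xs ys(1) by simp
    then show "op_on D f xs \<in> elts D" using is_algebraD[OF A f _ ys(2)] xs ys(1) by (simp add: D_def)
  qed
  have "subdirect_product S I B D"
    unfolding subdirect_product_def subalgebra_def
    using Dalg hin by (auto simp: D_def B_def quot_def h_def image_image)
  moreover have "alg_iso S A D h"
    unfolding alg_iso_def alg_hom_def
  proof (intro conjI ballI allI impI)
    show "h \<in> elts A \<rightarrow> elts D" by (simp add: D_def)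
    have "inj_on h (elts A)"
    proof (rule inj_onI, rule ccontr)
      fix a b assume ab: "a \<in> elts A" "b \<in> elts A" "h a = h b" "a \<noteq> b"
      then have p: "(a, b) \<in> I" by (simp add: I_def)
      have "h a (a, b) = h b (a, b)" using ab(3) by simp
      then have "rep (\<Theta> (a, b)) a = rep (\<Theta> (a, b)) b" using p by (simp add: h_def)
      then show False using rep_eq_iff[OF eq[OF p] ab(1,2)] \<Theta>(2)[OF p] by simp
    qed
    then show "bij_betw h (elts A) (elts D)" by (simp add: bij_betw_def D_def)
  qed (use hop in blast)
  moreover have "\<forall>p \<in> I. B p \<in> models S E"
    using quot_models[OF A E \<Theta>(1)] by (simp add: B_def)
  ultimately obtain p where p: "p \<in> I" "alg_iso S D (B p) (\<lambda>x. x p)"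
    using si[unfolded subdirectly_irreducible_def, THEN conjunct2, rule_format, of I B D h] by blast
  have "\<Theta> p \<subseteq> Id"
  proof clarify
    fix x y assume xy: "(x, y) \<in> \<Theta> p"
    then have A2: "x \<in> elts A" "y \<in> elts A" using rel_congruence_sub[OF \<Theta>(1)[OF p(1)]] by auto
    have "h x p = h y p" using rep_eq_iff[OF eq[OF p(1)] A2] xy p(1) by (simp add: h_def)
    then have "h x = h y" using p(2) A2 by (auto simp: alg_iso_def bij_betw_def D_def dest: inj_onD)
    then show "x = y"
      using \<open>alg_iso S A D h\<close> A2 by (auto simp: alg_iso_def bij_betw_def dest: inj_onD)
  qed
  then show False using \<Theta>(3)[OF p(1)] by blast
qed

text \<open>Some projection separates the two elements, and on two elements this is
  injectivity.\<close>

lemma two_element_subdirectly_irreducible: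
  fixes A :: "('f, 'a) algebra"
  assumes A: "A \<in> models S E" and el: "elts A = {p, q}" and pq: "p \<noteq> q"
  shows "subdirectly_irreducible S E A"
  unfolding subdirectly_irreducible_def
proof (intro conjI allI impI)
  show "A \<in> models S E" by (rule A)
  fix I :: "('a \<times> 'a) set" and B :: "'a \<times> 'a \<Rightarrow> ('f, 'a) algebra" and D h
  assume "(\<forall>i \<in> I. B i \<in> models S E) \<and> subdirect_product S I B D \<and> alg_iso S A D h"
  then have D: "subdirect_product S I B D" and h: "bij_betw h {p, q} (elts D)"
    by (auto simp: alg_iso_def el)
  have eD: "elts D = {h p, h q}" and hpq: "h p \<noteq> h q" using h pq by (auto simp: bij_betw_def)
  then obtain i where i: "i \<in> I" "h p i \<noteq> h q i"
    using subdirect_product_eqI[OF D, of "h p" "h q"] by auto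
  then have "inj_on (\<lambda>x. x i) (elts D)" by (auto simp: eD)
  then show "\<exists>i \<in> I. alg_iso S D (B i) (\<lambda>x. x i)"
    using subdirect_product_proj_iso[OF D i(1)] i(1) by blast
qed


section \<open>From coverings to generators\<close>

text \<open>A failure of a quasi-identity survives a homomorphism under which the premises hold and
  the two sides of the conclusion stay apart.\<close>

lemma not_satisfies_hom:
  assumes A: "is_algebra S A" and h: "alg_hom S A B h" and wf: "wf_qi S (QI I ps (c, d))"
    and y: "y \<in> I \<rightarrow> elts A" and ps: "\<forall>(a, b) \<in> set ps. h (val A y a) = h (val A y b)"
    and cd: "h (val A y c) \<noteq> h (val A y d)"
  shows "\<not> satisfies B (QI I ps (c, d))"
proof
  assume s: "satisfies B (QI I ps (c, d))"
  have v: "val B (h \<circ> y) t = h (val A y t)" if "wf_trm S I t" for t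
    using val_hom[OF A h that y] by simp
  have "h \<circ> y \<in> I \<rightarrow> elts B" using y h by (auto simp: alg_hom_def)
  moreover have "\<forall>(a, b) \<in> set ps. val B (h \<circ> y) a = val B (h \<circ> y) b"
  proof clarify
    fix a b assume ab: "(a, b) \<in> set ps"
    then have "wf_trm S I a" "wf_trm S I b" using wf by auto
    then show "val B (h \<circ> y) a = val B (h \<circ> y) b" using v ps ab by auto
  qed
  ultimately have "val B (h \<circ> y) c = val B (h \<circ> y) d" using s by simp
  then show False using v wf cd by simp
qed

text \<open>Here \<open>p\<close> codes pairs, \<open>i\<close> symbols and \<open>n\<close>
  numbers. The tags \<open>n 0\<close> and \<open>n 1\<close> distinguish variables from
  applications; \<open>n 0\<close> also ends an argument list.\<close>

fun trm_enc ::
    "('a \<times> 'a \<Rightarrow> 'a) \<Rightarrow> ('f \<Rightarrow> 'a) \<Rightarrow> (nat \<Rightarrow> 'a) \<Rightarrow> ('f, nat) trm \<Rightarrow> 'a" where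
  "trm_enc p i n (Var v) = p (n 0, n v)"
| "trm_enc p i n (App f ts) = p (n 1, p (i f, foldr (\<lambda>t a. p (trm_enc p i n t, a)) ts (n 0)))"

lemma inj_on_trm_enc:
  assumes p: "inj p" and i: "inj_on i (syms S)" and n: "inj n"
  shows "inj_on (trm_enc p i n) {t. wf_trm S V t}"
proof -
  have p': "p x = p y \<longleftrightarrow> x = y" for x y using p by (rule inj_eq)
  have n01: "n 0 \<noteq> n (Suc 0)" using n by (metis inj_eq n_not_Suc_n)
  have "t = u" if "wf_trm S V t" "wf_trm S V u" "trm_enc p i n t = trm_enc p i n u" for t u
    using that
  proof (induction t arbitrary: u)
    case (Var x)
    then show ?case using n n01 by (cases u) (auto simp: p' dest: injD)
  next
    case (App f ts)
    obtain g us where u: "u = App g us" using App.prems n01 by (cases u) (auto simp: p')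
    then have "i f = i g" using App.prems by (simp add: p')
    then have g: "g = f" using App.prems u i by (auto dest: inj_onD)
    \<comment> \<open>The terminator \<open>n 0\<close> may itself be the code of a pair, so the
      codes do not show the length of a list; the arity of the common symbol does.\<close>
    have len: "length ts = length us" using App.prems u g by simp
    have e: "foldr (\<lambda>t a. p (trm_enc p i n t, a)) ts (n 0) =
        foldr (\<lambda>t a. p (trm_enc p i n t, a)) us (n 0)"
      using App.prems u by (simp add: p')
    have ih: "\<forall>t \<in> set ts. \<forall>u. wf_trm S V u \<longrightarrow> trm_enc p i n t = trm_enc p i n u \<longrightarrow> t = u"
      using App.IH App.prems(1) by simp
    have "\<forall>u \<in> set us. wf_trm S V u" using App.prems(2) u by simp
    with len e ih have "ts = us"
      by (induction ts us rule: list_induct2) (simp_all add: p')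
    then show ?case using u g by simp
  qed
  then show ?thesis by (auto intro: inj_onI)
qed

text \<open>An infinite type has room for its own pairs and for the natural numbers, and
  \<open>S\<close> provides a coding of the symbols.\<close>

lemma ex_trm_encoding:
  fixes S :: "'f signature"
  assumes S: "|syms S| \<le>o |UNIV :: 'a set|" and inf: "infinite (UNIV :: 'a set)"
  shows "\<exists>enc :: ('f, nat) trm \<Rightarrow> 'a. inj_on enc {t. wf_trm S V t}"
proof -
  have "|UNIV \<times> UNIV :: ('a \<times> 'a) set| \<le>o |UNIV :: 'a set|"
    using card_of_Times_same_infinite[OF inf] by (rule ordIso_imp_ordLeq)
  then obtain p :: "'a \<times> 'a \<Rightarrow> 'a" where p: "inj p" unfolding card_of_ordLeq[symmetric] by auto
  obtain i :: "'f \<Rightarrow> 'a" where i: "inj_on i (syms S)" using S unfolding card_of_ordLeq[symmetric] by auto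
  obtain n :: "nat \<Rightarrow> 'a" where n: "inj n" using infinite_countable_subset[OF inf] by auto
  show ?thesis using inj_on_trm_enc[OF p i n] by blast
qed

text \<open>A failure in \<open>A\<close> involves finitely many elements. The subalgebra generated
  by them consists of values of terms, so it has a copy in \<open>'a\<close>. A homomorphism from it
  to a subdirectly irreducible algebra that separates the two sides of the conclusion preserves the
  failure.\<close>

lemma not_satisfies_subdirectly_irreducible:
  fixes A :: "('f, 'b) algebra"
  assumes E: "quasi_identities S E" and A: "A \<in> models S E" and q: "wf_qi S q" "\<not> satisfies A q"
    and S: "|syms S| \<le>o |UNIV :: 'a set|" and inf: "infinite (UNIV :: 'a set)"
  obtains B :: "('f, 'a) algebra" where "subdirectly_irreducible S E B" "\<not> satisfies B q"
proof (cases q rule: qi_code.cases)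
  case (1 I ps c d)
  have alg: "is_algebra S A" using A by (simp add: models_def)
  obtain x where x: "x \<in> I \<rightarrow> elts A" "\<forall>(a, b) \<in> set ps. val A x a = val A x b"
    "val A x c \<noteq> val A x d" using q(2) unfolding 1 by auto
  obtain enc :: "('f, nat) trm \<Rightarrow> 'a" where enc: "inj_on enc {t. wf_trm S I t}"
    using ex_trm_encoding[OF S inf] by blast
  obtain A' :: "('f, 'a) algebra" and e where A': "is_algebra S A'" "embedding S A' A e"
    and im: "x ` I \<subseteq> e ` elts A'" by (rule generated_subalgebra[OF alg x(1) enc])
  have eh: "alg_hom S A' A e" "inj_on e (elts A')" using A'(2) by (auto simp: embedding_def)
  have A'm: "A' \<in> models S E" by (rule models_embedding[OF A' A E])
  define y where "y n = inv_into (elts A') e (x n)" for n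
  have xe: "x n \<in> e ` elts A'" if "n \<in> I" for n using im that by blast
  have y: "y \<in> I \<rightarrow> elts A'" unfolding y_def using xe by (intro funcsetI inv_into_into)
  have ey: "(e \<circ> y) n = x n" if "n \<in> I" for n using f_inv_into_f[OF xe[OF that]] by (simp add: y_def)
  have v: "e (val A' y t) = val A x t" "val A' y t \<in> elts A'" if "wf_trm S I t" for t
    using val_hom[OF A'(1) eh(1) that y] val_cong[where A = A, OF that ey] val_wf_in[OF A'(1) that y]
    by simp_all
  have wf: "wf_trm S I c" "wf_trm S I d"
    "\<And>a b. (a, b) \<in> set ps \<Longrightarrow> wf_trm S I a \<and> wf_trm S I b" using q(1) unfolding 1 by auto
  have "val A' y c \<noteq> val A' y d" using v(1)[OF wf(1)] v(1)[OF wf(2)] x(3) by auto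
  then obtain B :: "('f, 'a) algebra" and h where
    B: "subdirectly_irreducible S E B" "alg_hom S A' B h" "h (val A' y c) \<noteq> h (val A' y d)"
    using separating_subdirectly_irreducible[OF A'm E v(2)[OF wf(1)] v(2)[OF wf(2)]] by blast
  have "\<forall>(a, b) \<in> set ps. h (val A' y a) = h (val A' y b)"
  proof clarify
    fix a b assume ab: "(a, b) \<in> set ps"
    then have w: "wf_trm S I a" "wf_trm S I b" using wf(3) by auto
    have "e (val A' y a) = e (val A' y b)" using v(1)[OF w(1)] v(1)[OF w(2)] x(2) ab by auto
    then have "val A' y a = val A' y b" using eh(2) v(2)[OF w(1)] v(2)[OF w(2)] by (auto dest: inj_onD)
    then show "h (val A' y a) = h (val A' y b)" by simp
  qed
  then have "\<not> satisfies B q"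
    using not_satisfies_hom[OF A'(1) B(2) _ y _ B(3)] q(1) unfolding 1 by blast
  then show thesis using that B(1) by blast
qed

text \<open>Over the fixed type \<open>'a\<close> all subdirectly irreducible algebras form one set,
  which can be covered. Choose for each part an algebra containing copies of all its members. A
  quasi-identity true in the chosen algebras is true in every subdirectly irreducible algebra over
  \<open>'a\<close>, hence in every model of \<open>E\<close>.\<close>

lemma generated_by_at_most_if_covered:
  fixes S :: "'f signature" and \<kappa> :: "'k rel"
  assumes \<kappa>: "Card_order \<kappa>" and inf: "infinite (UNIV :: 'a set)" and E: "quasi_identities S E"
    and S: "|syms S| \<le>o |UNIV :: 'a set|" and cov: "si_sets_covered TYPE('a) S E \<kappa>"
  shows "generated_by_at_most S E \<kappa>"
proof -
  let ?X = "{A :: ('f, 'a) algebra. subdirectly_irreducible S E A}"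
  have "\<exists>Y. ?X = (\<Union>\<alpha> \<in> Field \<kappa>. Y \<alpha>) \<and> (\<forall>\<alpha> \<in> Field \<kappa>. compatible S E (Y \<alpha>))"
    using cov[unfolded si_sets_covered_def, rule_format, of ?X] by simp
  then obtain Y where Y: "?X = (\<Union>\<alpha> \<in> Field \<kappa>. Y \<alpha>)" "\<And>\<alpha>. \<alpha> \<in> Field \<kappa> \<Longrightarrow> compatible S E (Y \<alpha>)"
    by blast
  have "\<forall>\<alpha> \<in> Field \<kappa>. \<exists>B :: ('f, ('f, ('f, 'a) algebra \<times> 'a) trm) algebra.
      B \<in> models S E \<and> (\<forall>A \<in> Y \<alpha>. \<exists>h. embedding S A B h)"
    using Y(2) unfolding compatible_def by blast
  from bchoice[OF this] obtain B :: "'k \<Rightarrow> ('f, ('f, ('f, 'a) algebra \<times> 'a) trm) algebra" where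
    B: "\<forall>\<alpha> \<in> Field \<kappa>. B \<alpha> \<in> models S E \<and> (\<forall>A \<in> Y \<alpha>. \<exists>h. embedding S A (B \<alpha>) h)" ..
  have "generated_by S E (B ` Field \<kappa>)"
    unfolding generated_by_def
  proof (intro conjI allI impI)
    show "B ` Field \<kappa> \<subseteq> models S E" using B by blast
    fix E' assume E': "quasi_identities S E' \<and> B ` Field \<kappa> \<subseteq> models S E'"
    show "quasivariety_le S E E'"
      unfolding quasivariety_le_def
    proof
      fix A :: "('f, ('f, nat) trm) algebra" assume A: "A \<in> models S E"
      have "satisfies A q" if q: "q \<in> E'" for q
      proof (rule ccontr)
        assume n: "\<not> satisfies A q"
        have wf: "wf_qi S q" using q E' by (simp add: quasi_identities_def)
        obtain C :: "('f, 'a) algebra" where C: "subdirectly_irreducible S E C" "\<not> satisfies C q"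
          by (rule not_satisfies_subdirectly_irreducible[OF E A wf n S inf])
        then obtain \<alpha> where \<alpha>: "\<alpha> \<in> Field \<kappa>" "C \<in> Y \<alpha>" using Y(1) by blast
        then obtain h where h: "embedding S C (B \<alpha>) h" using B by blast
        have "B \<alpha> \<in> models S E'" using E' \<alpha>(1) by blast
        then have "satisfies (B \<alpha>) q" using q by (simp add: models_def)
        moreover have "is_algebra S C" using C(1) by (simp add: subdirectly_irreducible_def models_def)
        ultimately show False using satisfies_embedding[OF _ h wf] C(2) by blast
      qed
      then show "A \<in> models S E'" using A by (simp add: models_def)
    qed
  qed
  moreover have "|B ` Field \<kappa>| \<le>o \<kappa>"
    using card_of_image card_of_Field_ordIso[OF \<kappa>] ordLeq_ordIso_trans by blast
  ultimately show ?thesis using generated_by_at_most_universal[OF E] by blast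
qed


section \<open>From finitely many generators to coverings\<close>

text \<open>Quotients of this absolutely free algebra by \<open>cg\<close> present models of
  \<open>E\<close> by generators and relations.\<close>

definition trm_alg :: "'f signature \<Rightarrow> 'v set \<Rightarrow> ('f, ('f, 'v) trm) algebra" where
  "trm_alg S V = \<lparr>elts = {t. wf_trm S V t}, op_on = App\<rparr>"

lemma trm_alg_algebra: "is_algebra S (trm_alg S V)"
  by (auto simp: trm_alg_def is_algebra_def)

lemma val_trm_alg_hom:
  assumes "is_algebra S B" "w \<in> V \<rightarrow> elts B"
  shows "alg_hom S (trm_alg S V) B (val B w)"
  using val_wf_in[OF assms(1) _ assms(2)] by (auto simp: alg_hom_def trm_alg_def)

text \<open>Each element of \<open>A\<close> is the variable that names it, hence the identity
  assignment.\<close>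

definition pos_diagram :: "'f signature \<Rightarrow> ('f, 'a) algebra \<Rightarrow> ('f, 'a) trm rel" where
  "pos_diagram S A = ker {t. wf_trm S (elts A) t} (val A (\<lambda>a. a))"

text \<open>This is the finitary form of embeddability of \<open>A\<close> into an ultrapower of
  \<open>H\<close>: \<open>F\<close> is a finite set of equations of the diagram and
  \<open>N\<close> a finite set of inequations.\<close>

definition finitely_realised :: "'f signature \<Rightarrow> ('f, 'a) algebra \<Rightarrow> ('f, 'b) algebra \<Rightarrow> bool" where
  "finitely_realised S A H \<longleftrightarrow>
     (\<forall>F N. finite F \<and> F \<subseteq> pos_diagram S A \<and> finite N \<and> N \<subseteq> elts A \<times> elts A - Id \<longrightarrow>
        (\<exists>w \<in> elts A \<rightarrow> elts H. (\<forall>(s, t) \<in> F. val H w s = val H w t) \<and> (\<forall>(a, b) \<in> N. w a \<noteq> w b)))"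

lemma pos_diagram_opI:
  assumes "is_algebra S A" "f \<in> syms S" "length xs = arity S f" "set xs \<subseteq> elts A"
  shows "(Var (op_on A f xs), App f (map Var xs)) \<in> pos_diagram S A"
  using assms is_algebraD[OF assms] by (auto simp: pos_diagram_def ker_def comp_def)

text \<open>The assumption on \<theta> is that it contains the operation table of \<open>A\<close>,
  with \<open>g a\<close> as the variable naming \<open>a\<close>. It is applied with the identity
  and with \<open>Pair A\<close> as \<open>g\<close>.\<close>

lemma hom_into_quot_trm_alg:
  assumes A: "is_algebra S A" and \<theta>: "rel_congruence S E (trm_alg S V) \<theta>"
    and g: "g \<in> elts A \<rightarrow> V"
    and op: "\<And>f xs. f \<in> syms S \<Longrightarrow> length xs = arity S f \<Longrightarrow> set xs \<subseteq> elts A \<Longrightarrow>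
      (Var (g (op_on A f xs)), App f (map (\<lambda>a. Var (g a)) xs)) \<in> \<theta>"
  shows "alg_hom S A (quot (trm_alg S V) \<theta>) (\<lambda>a. rep \<theta> (Var (g a)))"
  unfolding alg_hom_def
proof (intro conjI ballI allI impI)
  have eq: "equiv (elts (trm_alg S V)) \<theta>" using \<theta> by (simp add: rel_congruence_def)
  show "(\<lambda>a. rep \<theta> (Var (g a))) \<in> elts A \<rightarrow> elts (quot (trm_alg S V) \<theta>)"
    using g by (auto simp: quot_def trm_alg_def intro!: imageI)
  fix f xs assume f: "f \<in> syms S" and xs: "length xs = arity S f \<and> set xs \<subseteq> elts A"
  let ?ts = "map (\<lambda>a. Var (g a)) xs"
  have r: "(Var (g (op_on A f xs)), App f ?ts) \<in> \<theta>" using op[OF f] xs by blast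
  have ts: "set ?ts \<subseteq> elts (trm_alg S V)" using xs g by (auto simp: trm_alg_def)
  have "rep \<theta> (Var (g (op_on A f xs))) = rep \<theta> (App f ?ts)"
    using r rep_eq_iff[OF eq] rel_congruence_sub[OF \<theta>] by blast
  also have "App f ?ts = op_on (trm_alg S V) f ?ts" by (simp add: trm_alg_def)
  also have "rep \<theta> \<dots> = op_on (quot (trm_alg S V) \<theta>) f (map (rep \<theta>) ?ts)"
    using alg_homD[OF quot_hom[OF trm_alg_algebra \<theta>] f _ ts] xs by simp
  finally show "rep \<theta> (Var (g (op_on A f xs))) =
      op_on (quot (trm_alg S V) \<theta>) f (map (\<lambda>a. rep \<theta> (Var (g a))) xs)"
    by (simp add: comp_def)
qed

section \<open>Restriction to finitely many variables and renaming\<close>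

lemma wf_trm_mono: "wf_trm S V t \<Longrightarrow> V \<subseteq> W \<Longrightarrow> wf_trm S W t"
  by (induction t) auto

lemma wf_trm_finite_vars: "wf_trm S V t \<Longrightarrow> \<exists>W. finite W \<and> W \<subseteq> V \<and> wf_trm S W t"
proof (induction t)
  case (Var x)
  then show ?case by (intro exI[of _ "{x}"]) simp
next
  case (App f ts)
  then have "\<forall>t \<in> set ts. \<exists>W. finite W \<and> W \<subseteq> V \<and> wf_trm S W t" by simp
  from bchoice[OF this] obtain W where
    W: "\<forall>t \<in> set ts. finite (W t) \<and> W t \<subseteq> V \<and> wf_trm S (W t) t" ..
  have "wf_trm S (\<Union>t \<in> set ts. W t) t" if "t \<in> set ts" for t
    by (rule wf_trm_mono[of S "W t"]) (use W that in auto)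
  then show ?case using W App.prems by (intro exI[of _ "\<Union>t \<in> set ts. W t"]) auto
qed

lemma wf_trms_finite_vars:
  assumes "finite P" "\<forall>t \<in> P. wf_trm S V t"
  shows "\<exists>W. finite W \<and> W \<subseteq> V \<and> (\<forall>t \<in> P. wf_trm S W t)"
proof -
  have "\<forall>t \<in> P. \<exists>W. finite W \<and> W \<subseteq> V \<and> wf_trm S W t" using assms(2) wf_trm_finite_vars by blast
  from bchoice[OF this] obtain W where
    W: "\<forall>t \<in> P. finite (W t) \<and> W t \<subseteq> V \<and> wf_trm S (W t) t" ..
  have "wf_trm S (\<Union>t \<in> P. W t) t" if "t \<in> P" for t
    by (rule wf_trm_mono[of S "W t"]) (use W that in auto)
  then show ?thesis using W assms(1) by (intro exI[of _ "\<Union>t \<in> P. W t"]) auto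
qed

lemma wf_map_trm: "wf_trm S V t \<Longrightarrow> wf_trm S (g ` V) (map_trm (\<lambda>f. f) g t)"
  by (induction t) auto

lemma val_map_trm: "val A x (map_trm (\<lambda>f. f) g t) = val A (\<lambda>v. x (g v)) t"
proof (induction t)
  case (App f ts)
  have "map (val A x) (map (map_trm (\<lambda>f. f) g) ts) = map (val A (\<lambda>v. x (g v))) ts"
    unfolding map_map by (rule map_cong[OF refl]) (simp only: comp_apply App.IH)
  then show ?case by (simp only: trm.map val.simps)
qed simp

lemma generated_by_models:
  assumes "generated_by S E G" "H \<in> G"
  shows "H \<in> models S E" "is_algebra S H"
  using assms by (auto simp: generated_by_def models_def)

text \<open>Only finitely many variables occur. Numbering them turns the situation into a
  quasi-identity that fails in \<open>A\<close>, so it cannot hold in all generators.\<close>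

lemma generator_falsifies:
  fixes A :: "('f, 'a) algebra" and G :: "('f, 'b) algebra set" and V :: "'v set"
  assumes E: "quasi_identities S E" and G: "generated_by S E G" and A: "A \<in> models S E"
    and F: "finite F" "\<forall>(a, b) \<in> F. wf_trm S V a \<and> wf_trm S V b"
    and cd: "wf_trm S V c" "wf_trm S V d"
    and x: "x \<in> V \<rightarrow> elts A" "\<forall>(a, b) \<in> F. val A x a = val A x b" "val A x c \<noteq> val A x d"
  obtains H w where "H \<in> G" "w \<in> V \<rightarrow> elts H" "\<forall>(a, b) \<in> F. val H w a = val H w b"
    "val H w c \<noteq> val H w d"
proof -
  let ?P = "fst ` F \<union> snd ` F \<union> {c, d}"
  have "finite ?P" "\<forall>t \<in> ?P. wf_trm S V t" using F cd by auto
  from wf_trms_finite_vars[OF this] obtain W where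
    W: "finite W" "W \<subseteq> V" "\<forall>t \<in> ?P. wf_trm S W t" by blast
  have Wc: "wf_trm S W c" "wf_trm S W d" using W(3) by auto
  have WF: "wf_trm S W a" "wf_trm S W b" if "(a, b) \<in> F" for a b
    using W(3) imageI[OF that, of fst] imageI[OF that, of snd] by simp_all
  obtain g :: "'v \<Rightarrow> nat" where g: "inj_on g W" using finite_imp_inj_to_nat_seg[OF W(1)] by auto
  from finite_list[OF finite_imageI[OF F(1)]]
  obtain ps where ps: "set ps = (\<lambda>(a, b). (map_trm (\<lambda>f. f) g a, map_trm (\<lambda>f. f) g b)) ` F" ..
  define q where "q = QI (g ` W) ps (map_trm (\<lambda>f. f) g c, map_trm (\<lambda>f. f) g d)"
  have "\<forall>(a, b) \<in> set ps. wf_trm S (g ` W) a \<and> wf_trm S (g ` W) b"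
    unfolding ps using WF by (auto intro: wf_map_trm)
  then have q: "wf_qi S q" using W(1) Wc by (simp add: q_def wf_map_trm)
  have "\<not> satisfies A q"
  proof
    assume s: "satisfies A q"
    define y where "y = x \<circ> inv_into W g"
    have v: "val A y (map_trm (\<lambda>f. f) g t) = val A x t" if "wf_trm S W t" for t
      unfolding val_map_trm by (rule val_cong[OF that]) (simp add: y_def g)
    have "y \<in> g ` W \<rightarrow> elts A" using funcset_mem[OF x(1)] W(2) g by (auto simp: y_def)
    moreover have "\<forall>(a, b) \<in> set ps. val A y a = val A y b"
      unfolding ps
    proof clarify
      fix a b assume ab: "(a, b) \<in> F"
      then have "val A x a = val A x b" using x(2) by blast
      then show "val A y (map_trm (\<lambda>f. f) g a) = val A y (map_trm (\<lambda>f. f) g b)"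
        unfolding v[OF WF(1)[OF ab]] v[OF WF(2)[OF ab]] .
    qed
    ultimately have "val A y (map_trm (\<lambda>f. f) g c) = val A y (map_trm (\<lambda>f. f) g d)"
      using s unfolding q_def satisfies.simps by blast
    then show False using x(3) unfolding v[OF Wc(1)] v[OF Wc(2)] by blast
  qed
  have "\<exists>H \<in> G. \<not> satisfies H q"
  proof (rule ccontr)
    assume "\<not> ?thesis"
    then have "G \<subseteq> models S {q}" using generated_by_models(2)[OF G] by (auto simp: models_def)
    moreover have q1: "quasi_identities S {q}" using q by (simp add: quasi_identities_def)
    ultimately have "quasivariety_le S E {q}" using G unfolding generated_by_def by blast
    from quasivariety_le_universal[OF this E q1] have "A \<in> models S {q}" using A by blast
    then show False using \<open>\<not> satisfies A q\<close> by (simp add: models_def)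
  qed
  then obtain H where H: "H \<in> G" "\<not> satisfies H q" by blast
  then have alg: "is_algebra S H" using generated_by_models(2)[OF G] by blast
  obtain y where y: "y \<in> g ` W \<rightarrow> elts H" "\<forall>(a, b) \<in> set ps. val H y a = val H y b"
    "val H y (map_trm (\<lambda>f. f) g c) \<noteq> val H y (map_trm (\<lambda>f. f) g d)"
    using H(2) unfolding q_def satisfies.simps by blast
  \<comment> \<open>Outside \<open>W\<close> the value of \<open>c\<close> serves as default: it is
    an element of \<open>H\<close> even if \<open>W\<close> is empty.\<close>
  define w where "w v = (if v \<in> W then y (g v) else val H y (map_trm (\<lambda>f. f) g c))" for v
  have v: "val H w t = val H y (map_trm (\<lambda>f. f) g t)" if "wf_trm S W t" for t
    unfolding val_map_trm by (rule val_cong[OF that]) (simp add: w_def)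
  have "w v \<in> elts H" for v
    using funcset_mem[OF y(1), of "g v"] val_wf_in[OF alg wf_map_trm[OF Wc(1)] y(1)]
    by (simp add: w_def)
  then have "w \<in> V \<rightarrow> elts H" by (intro funcsetI)
  moreover have "\<forall>(a, b) \<in> F. val H w a = val H w b"
  proof clarify
    fix a b assume ab: "(a, b) \<in> F"
    then have "val H y (map_trm (\<lambda>f. f) g a) = val H y (map_trm (\<lambda>f. f) g b)"
      using bspec[OF y(2)[unfolded ps] imageI] by fastforce
    then show "val H w a = val H w b" unfolding v[OF WF(1)[OF ab]] v[OF WF(2)[OF ab]] .
  qed
  moreover have "val H w c \<noteq> val H w d" using y(3) unfolding v[OF Wc(1)] v[OF Wc(2)] .
  ultimately show thesis by (rule that[OF H(1)])
qed

(* A monolith pair (u, v) is identified as soon as some pair in N is, and finitely many equations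
   of A suffice for this. A generator where these hold but u and v stay apart therefore keeps all
   pairs in N apart. *)
lemma subdirectly_irreducible_realised:
  fixes A :: "('f, 'a) algebra" and G :: "('f, 'b) algebra set"
  assumes E: "quasi_identities S E" and G: "generated_by S E G"
    and si: "subdirectly_irreducible S E A"
    and F: "finite F" "F \<subseteq> pos_diagram S A" and N: "finite N" "N \<subseteq> elts A \<times> elts A - Id"
  obtains H w where "H \<in> G" "w \<in> elts A \<rightarrow> elts H" "\<forall>(s, t) \<in> F. val H w s = val H w t"
    "\<forall>(a, b) \<in> N. w a \<noteq> w b"
proof -
  have Am: "A \<in> models S E" and A: "is_algebra S A"
    using si by (auto simp: subdirectly_irreducible_def models_def)
  obtain u v where uv: "u \<in> elts A" "v \<in> elts A" "u \<noteq> v"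
    and mono: "\<And>\<theta>. rel_congruence S E A \<theta> \<Longrightarrow> (u, v) \<notin> \<theta> \<Longrightarrow> \<theta> \<subseteq> Id"
    by (rule subdirectly_irreducible_monolith[OF si E]) blast
  let ?T = "trm_alg S (elts A)"
  let ?K = "pos_diagram S A"
  have K: "?K \<subseteq> elts ?T \<times> elts ?T" by (auto simp: pos_diagram_def ker_def trm_alg_def)
  have "\<exists>R. finite R \<and> R \<subseteq> insert (Var (fst p), Var (snd p)) ?K \<and> (Var u, Var v) \<in> cg S E ?T R"
    if pN: "p \<in> N" for p
  proof -
    obtain a b where p: "p = (a, b)" and ab: "a \<in> elts A" "b \<in> elts A" "a \<noteq> b"
      using subsetD[OF N(2) pN] by (cases p) auto
    let ?R = "insert (Var a, Var b) ?K"
    let ?\<theta> = "cg S E ?T ?R"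
    have R: "?R \<subseteq> elts ?T \<times> elts ?T" using K ab by (auto simp: trm_alg_def)
    have \<theta>: "rel_congruence S E ?T ?\<theta>" by (rule rel_congruence_cg[OF trm_alg_algebra E R])
    then have eq: "equiv (elts ?T) ?\<theta>" by (simp add: rel_congruence_def)
    have R\<theta>: "?R \<subseteq> ?\<theta>" by (rule cg_superset)
    let ?h = "\<lambda>x. rep ?\<theta> (Var x)"
    have "alg_hom S A (quot ?T ?\<theta>) ?h"
    proof (rule hom_into_quot_trm_alg[OF A \<theta>])
      show "(Var (op_on A f xs), App f (map Var xs)) \<in> ?\<theta>"
        if "f \<in> syms S" "length xs = arity S f" "set xs \<subseteq> elts A" for f xs
        using pos_diagram_opI[OF A that] R\<theta> by blast
    qed simp
    then have k: "rel_congruence S E A (ker (elts A) ?h)"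
      by (rule rel_congruence_ker[OF A _ quot_models[OF trm_alg_algebra E \<theta>] E])
    have T: "Var x \<in> elts ?T" if "x \<in> elts A" for x using that by (simp add: trm_alg_def)
    have "?h a = ?h b" using R\<theta> rep_eq_iff[OF eq T[OF ab(1)] T[OF ab(2)]] by simp
    then have "(a, b) \<in> ker (elts A) ?h" using ab by (simp add: ker_def)
    \<comment> \<open>The kernel contains the pair of distinct elements \<open>a\<close> and
      \<open>b\<close>, so it cannot omit the monolith pair.\<close>
    then have "(u, v) \<in> ker (elts A) ?h" using mono[OF k] ab(3) by blast
    then have "(Var u, Var v) \<in> ?\<theta>"
      using rep_eq_iff[OF eq T[OF uv(1)] T[OF uv(2)]] by (simp add: ker_def)
    then show ?thesis using cg_finitary[OF trm_alg_algebra E R] unfolding p by (metis fst_conv snd_conv)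
  qed
  then have "\<forall>p \<in> N. \<exists>R. finite R \<and> R \<subseteq> insert (Var (fst p), Var (snd p)) ?K \<and>
      (Var u, Var v) \<in> cg S E ?T R" by blast
  from bchoice[OF this] obtain R where R: "\<forall>p \<in> N. finite (R p) \<and>
      R p \<subseteq> insert (Var (fst p), Var (snd p)) ?K \<and> (Var u, Var v) \<in> cg S E ?T (R p)" ..
  \<comment> \<open>Intersecting with the diagram drops the added equation of \<open>a\<close> and
    \<open>b\<close>, which is false in \<open>A\<close>.\<close>
  define F' where "F' = F \<union> (\<Union>p \<in> N. R p \<inter> ?K)"
  have F'K: "F' \<subseteq> ?K" using F(2) by (auto simp: F'_def)
  have "finite (R p \<inter> ?K)" if "p \<in> N" for p using R that by blast
  then have F'fin: "finite F'" unfolding F'_def using F(1) N(1) by (intro finite_UnI finite_UN_I)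
  have F': "\<forall>(a, b) \<in> F'. wf_trm S (elts A) a \<and> wf_trm S (elts A) b"
    "\<forall>(a, b) \<in> F'. val A (\<lambda>a. a) a = val A (\<lambda>a. a) b"
    using F'K by (auto simp: pos_diagram_def ker_def)
  have Var: "wf_trm S (elts A) (Var u)" "wf_trm S (elts A) (Var v)" using uv by simp_all
  obtain H w where H: "H \<in> G" "w \<in> elts A \<rightarrow> elts H"
    "\<forall>(a, b) \<in> F'. val H w a = val H w b" "val H w (Var u) \<noteq> val H w (Var v)"
    by (rule generator_falsifies[OF E G Am F'fin F'(1) Var _ F'(2)]) (use uv(3) in auto)
  note Hm = generated_by_models[OF G H(1)]
  have "w a \<noteq> w b" if ab: "(a, b) \<in> N" for a b
  proof
    assume e: "w a = w b"
    let ?k = "ker (elts ?T) (val H w)"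
    have "rel_congruence S E ?T ?k"
      by (rule rel_congruence_ker[OF trm_alg_algebra val_trm_alg_hom[OF Hm(2) H(2)] Hm(1) E])
    moreover have "R (a, b) \<subseteq> ?k"
    proof
      fix r assume r: "r \<in> R (a, b)"
      then have "r = (Var a, Var b) \<or> r \<in> ?K" using R ab by fastforce
      then show "r \<in> ?k"
      proof
        assume "r = (Var a, Var b)"
        then show ?thesis using e ab N(2) by (auto simp: ker_def trm_alg_def)
      next
        assume k: "r \<in> ?K"
        then have "r \<in> F'" using r ab by (auto simp: F'_def)
        then show ?thesis using k K H(3) by (auto simp: ker_def)
      qed
    qed
    ultimately have "cg S E ?T (R (a, b)) \<subseteq> ?k" by (rule cg_least)
    then have "(Var u, Var v) \<in> ?k" using R ab by blast
    then show False using H(4) by (simp add: ker_def)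
  qed
  then show thesis using that[OF H(1,2)] H(3) by (auto simp: F'_def)
qed

text \<open>If every generator missed some finite part of the diagram, the union of these parts,
  finite because \<open>G\<close> is, would be missed by all of them.\<close>

lemma subdirectly_irreducible_finitely_realised:
  fixes A :: "('f, 'a) algebra" and G :: "('f, 'b) algebra set"
  assumes E: "quasi_identities S E" and G: "generated_by S E G" "finite G"
    and si: "subdirectly_irreducible S E A"
  shows "\<exists>H \<in> G. finitely_realised S A H"
proof (rule ccontr)
  let ?ok = "\<lambda>H F N. \<exists>w \<in> elts A \<rightarrow> elts H.
      (\<forall>(s, t) \<in> F. val H w s = val H w t) \<and> (\<forall>(a, b) \<in> N. w a \<noteq> w b)"
  let ?dia = "\<lambda>F N. finite F \<and> F \<subseteq> pos_diagram S A \<and> finite N \<and> N \<subseteq> elts A \<times> elts A - Id"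
  assume "\<not> ?thesis"
  then have "\<forall>H \<in> G. \<not> finitely_realised S A H" by blast
  then have "\<forall>H \<in> G. \<exists>F N. ?dia F N \<and> \<not> ?ok H F N"
    unfolding finitely_realised_def by (simp only: not_all not_imp)
  from bchoice[OF this] obtain F where "\<forall>H \<in> G. \<exists>N. ?dia (F H) N \<and> \<not> ?ok H (F H) N" ..
  from bchoice[OF this] obtain N where no: "\<forall>H \<in> G. ?dia (F H) (N H) \<and> \<not> ?ok H (F H) (N H)" ..
  let ?F = "\<Union>H \<in> G. F H" and ?N = "\<Union>H \<in> G. N H"
  have fin: "finite ?F" "finite ?N" using no G(2) by simp_all
  have sub: "?F \<subseteq> pos_diagram S A" "?N \<subseteq> elts A \<times> elts A - Id"
    unfolding UN_subset_iff using no by blast+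
  obtain H w where H: "H \<in> G" "w \<in> elts A \<rightarrow> elts H"
    "\<forall>(s, t) \<in> ?F. val H w s = val H w t" "\<forall>(a, b) \<in> ?N. w a \<noteq> w b"
    by (rule subdirectly_irreducible_realised[OF E G(1) si fin(1) sub(1) fin(2) sub(2)])
  have "?ok H (F H) (N H)"
    by (intro bexI[OF _ H(2)] conjI ballI; rule bspec[OF H(3)] bspec[OF H(4)], erule UN_I[OF H(1)])
  then show False using no H(1) by blast
qed

(* The algebra presented by the disjoint union of the diagrams of all members of X: by
   compactness, no two elements of a member are identified in it. *)
lemma compatible_if_finitely_realised:
  fixes X :: "('f, 'a) algebra set" and H :: "('f, 'b) algebra"
  assumes E: "quasi_identities S E"
    and X: "\<And>A. A \<in> X \<Longrightarrow> is_algebra S A \<and> H \<in> models S E \<and> finitely_realised S A H"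
  shows "compatible S E X"
proof -
  let ?V = "SIGMA A : X. elts A"
  let ?T = "trm_alg S ?V"
  \<comment> \<open>Renaming \<open>a\<close> to \<open>(A, a)\<close> makes the diagrams of
    different members of \<open>X\<close> disjoint.\<close>
  define tag :: "('f, 'a) algebra \<Rightarrow> ('f, 'a) trm \<Rightarrow> ('f, ('f, 'a) algebra \<times> 'a) trm"
    where "tag A = map_trm (\<lambda>f. f) (Pair A)" for A
  let ?D = "SIGMA A : X. pos_diagram S A"
  let ?c = "\<lambda>(A, s, t). (tag A s, tag A t)"
  let ?\<theta> = "cg S E ?T (?c ` ?D)"
  have tag: "tag A t \<in> elts ?T" if "A \<in> X" "wf_trm S (elts A) t" for A t
    using wf_trm_mono[OF wf_map_trm[OF that(2), of "Pair A"], of ?V] that(1)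
    by (auto simp: tag_def trm_alg_def)
  have D: "?c ` ?D \<subseteq> elts ?T \<times> elts ?T"
    using tag by (auto simp: pos_diagram_def ker_def)
  have \<theta>: "rel_congruence S E ?T ?\<theta>" by (rule rel_congruence_cg[OF trm_alg_algebra E D])
  then have eq: "equiv (elts ?T) ?\<theta>" by (simp add: rel_congruence_def)
  have "embedding S A (quot ?T ?\<theta>) (\<lambda>a. rep ?\<theta> (Var (A, a)))" if A: "A \<in> X" for A
    unfolding embedding_def
  proof
    show "alg_hom S A (quot ?T ?\<theta>) (\<lambda>a. rep ?\<theta> (Var (A, a)))"
    proof (rule hom_into_quot_trm_alg[OF _ \<theta>])
      show "is_algebra S A" using X[OF A] by blast
      show "Pair A \<in> elts A \<rightarrow> ?V" using A by auto
      fix f xs assume f: "f \<in> syms S" "length xs = arity S f" "set xs \<subseteq> elts A"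
      have "(A, Var (op_on A f xs), App f (map Var xs)) \<in> ?D"
        using pos_diagram_opI[OF _ f] X[OF A] A by blast
      then have "?c (A, Var (op_on A f xs), App f (map Var xs)) \<in> ?\<theta>"
        using cg_superset[of "?c ` ?D"] by blast
      then show "(Var (A, op_on A f xs), App f (map (\<lambda>a. Var (A, a)) xs)) \<in> ?\<theta>"
        by (simp add: tag_def comp_def)
    qed
    show "inj_on (\<lambda>a. rep ?\<theta> (Var (A, a))) (elts A)"
    proof (rule inj_onI, rule ccontr)
      fix a b assume ab: "a \<in> elts A" "b \<in> elts A" "a \<noteq> b"
        and "rep ?\<theta> (Var (A, a)) = rep ?\<theta> (Var (A, b))"
      then have "(Var (A, a), Var (A, b)) \<in> ?\<theta>"
        using rep_eq_iff[OF eq, of "Var (A, a)" "Var (A, b)"] A by (simp add: trm_alg_def)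
      then obtain R where R: "finite R" "R \<subseteq> ?c ` ?D" "(Var (A, a), Var (A, b)) \<in> cg S E ?T R"
        by (rule cg_finitary[OF trm_alg_algebra E D])
      then obtain R' where R': "finite R'" "R' \<subseteq> ?D" "R = ?c ` R'"
        using finite_subset_image by meson
      \<comment> \<open>Every member of \<open>X\<close> needs a realisation, even if
        \<open>R'\<close> contains no equation of it, because \<open>y\<close> below must be defined
        on all of \<open>?V\<close>. The intersection drops the inequation where \<open>a\<close> or
        \<open>b\<close> is not an element of \<open>C\<close>.\<close>
      have "\<forall>C \<in> X. \<exists>w \<in> elts C \<rightarrow> elts H. (\<forall>(s, t) \<in> R' `` {C}. val H w s = val H w t) \<and>
          (\<forall>(c, d) \<in> {(a, b)} \<inter> (elts C \<times> elts C - Id). w c \<noteq> w d)"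
      proof
        fix C assume C: "C \<in> X"
        have "finitely_realised S C H" using X[OF C] by blast
        moreover have "finite (R' `` {C})" using R'(1) by (rule finite_Image)
        moreover have "R' `` {C} \<subseteq> pos_diagram S C" using R'(2) by blast
        ultimately show "\<exists>w \<in> elts C \<rightarrow> elts H. (\<forall>(s, t) \<in> R' `` {C}. val H w s = val H w t) \<and>
            (\<forall>(c, d) \<in> {(a, b)} \<inter> (elts C \<times> elts C - Id). w c \<noteq> w d)"
          unfolding finitely_realised_def by (metis Int_lower2 finite.intros finite_Int)
      qed
      from bchoice[OF this[unfolded Bex_def]] obtain w where w': "\<forall>C \<in> X. w C \<in> elts C \<rightarrow> elts H \<and>
          (\<forall>(s, t) \<in> R' `` {C}. val H (w C) s = val H (w C) t) \<and>
          (\<forall>(c, d) \<in> {(a, b)} \<inter> (elts C \<times> elts C - Id). w C c \<noteq> w C d)" ..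
      have w: "\<And>C. C \<in> X \<Longrightarrow> w C \<in> elts C \<rightarrow> elts H"
        "\<And>C s t. C \<in> X \<Longrightarrow> (s, t) \<in> R' `` {C} \<Longrightarrow> val H (w C) s = val H (w C) t"
        "\<And>C. C \<in> X \<Longrightarrow> (a, b) \<in> elts C \<times> elts C - Id \<Longrightarrow> w C a \<noteq> w C b"
        using w' by blast+
      \<comment> \<open>All realisations take values in the same \<open>H\<close>, so they combine
        to one assignment.\<close>
      define y where "y = (\<lambda>(C, c). w C c)"
      have y: "y \<in> ?V \<rightarrow> elts H" using w(1) by (auto simp: y_def)
      have yt: "val H y (tag C t) = val H (w C) t" for C t
        by (simp add: tag_def val_map_trm y_def comp_def)
      have Hm: "H \<in> models S E" "is_algebra S H" using X[OF A] by (auto simp: models_def)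
      let ?k = "ker (elts ?T) (val H y)"
      have "rel_congruence S E ?T ?k"
        by (rule rel_congruence_ker[OF trm_alg_algebra val_trm_alg_hom[OF Hm(2) y] Hm(1) E])
      moreover have "R \<subseteq> ?k"
      proof
        fix r assume "r \<in> R"
        then obtain C s t where r: "r = (tag C s, tag C t)" "(C, s, t) \<in> R'"
          unfolding R'(3) by auto
        then have "C \<in> X" "wf_trm S (elts C) s" "wf_trm S (elts C) t"
          using R'(2) by (auto simp: pos_diagram_def ker_def)
        then show "r \<in> ?k" using r w(2)[of C s t] tag by (auto simp: ker_def yt)
      qed
      ultimately have "cg S E ?T R \<subseteq> ?k" by (rule cg_least)
      then have "y (A, a) = y (A, b)" using R(3) by (auto simp: ker_def)
      then show False using w(3)[OF A] ab by (simp add: y_def)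
    qed
  qed
  then show ?thesis
    unfolding compatible_def using quot_models[OF trm_alg_algebra E \<theta>] by blast
qed

text \<open>The generators, carried into \<open>Field \<kappa>\<close> by an injection, index the
  parts; a part collects the algebras finitely realised in its generator.\<close>

lemma covered_if_generated_by_finite:
  fixes S :: "'f signature" and \<kappa> :: "'k rel"
  assumes \<kappa>: "Card_order \<kappa>" and fin: "finite (Field \<kappa>)" and E: "quasi_identities S E"
    and gen: "generated_by_at_most S E \<kappa>"
  shows "si_sets_covered TYPE('a) S E \<kappa>"
  unfolding si_sets_covered_def
proof (intro allI impI)
  fix X :: "('f, 'a) algebra set" assume X: "\<forall>A \<in> X. subdirectly_irreducible S E A"
  obtain G :: "('f, ('f, nat) trm) algebra set" where G: "|G| \<le>o \<kappa>" "generated_by S E G"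
    using gen unfolding generated_by_at_most_def by blast
  have "|G| \<le>o |Field \<kappa>|"
    using G(1) card_of_Field_ordIso[OF \<kappa>] ordIso_symmetric ordLeq_ordIso_trans by blast
  then obtain g where g: "inj_on g G" "g ` G \<subseteq> Field \<kappa>" unfolding card_of_ordLeq[symmetric] by blast
  have finG: "finite G" using g fin finite_subset finite_imageD by metis
  define Y where "Y \<alpha> = {A \<in> X. \<exists>H \<in> G. g H = \<alpha> \<and> finitely_realised S A H}" for \<alpha>
  have "X = (\<Union>\<alpha> \<in> Field \<kappa>. Y \<alpha>)"
  proof
    show "X \<subseteq> (\<Union>\<alpha> \<in> Field \<kappa>. Y \<alpha>)"
    proof
      fix A assume A: "A \<in> X"
      then obtain H where "H \<in> G" "finitely_realised S A H"
        using subdirectly_irreducible_finitely_realised[OF E G(2) finG] X by blast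
      then show "A \<in> (\<Union>\<alpha> \<in> Field \<kappa>. Y \<alpha>)" using A g(2) by (auto simp: Y_def)
    qed
  qed (auto simp: Y_def)
  moreover have "compatible S E (Y \<alpha>)" for \<alpha>
  \<comment> \<open>At an index outside the image of \<open>g\<close> the part is empty, so an
    arbitrary value of \<open>inv_into\<close> does no harm.\<close>
  proof (rule compatible_if_finitely_realised[OF E, where H = "inv_into G g \<alpha>"])
    fix A assume "A \<in> Y \<alpha>"
    then obtain H where H: "A \<in> X" "H \<in> G" "g H = \<alpha>" "finitely_realised S A H" by (auto simp: Y_def)
    then have "inv_into G g \<alpha> = H" using g(1) by auto
    then show "is_algebra S A \<and> inv_into G g \<alpha> \<in> models S E \<and> finitely_realised S A (inv_into G g \<alpha>)"
      using H X generated_by_models(1)[OF G(2)]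
      by (simp add: subdirectly_irreducible_def models_def)
  qed
  ultimately show "\<exists>Y. X = (\<Union>\<alpha> \<in> Field \<kappa>. Y \<alpha>) \<and> (\<forall>\<alpha> \<in> Field \<kappa>. compatible S E (Y \<alpha>))" by blast
qed


section \<open>The counterexample for infinite cardinals\<close>

text \<open>By induction on the size \<open>n\<close>, inserting one more element at each step,
  there are at most \<open>|A|\<close> subsets of size \<open>n\<close>; then take the countable
  union.\<close>

lemma card_of_Fpow_infinite:
  assumes inf: "infinite A"
  shows "|Fpow A| \<le>o |A|"
proof -
  let ?P = "\<lambda>n. {X \<in> Fpow A. card X = n}"
  have "|?P n| \<le>o |A|" for n
  proof (induction n)
    case 0
    have "?P 0 \<subseteq> {{}}" by (auto simp: Fpow_def)
    then have "finite (?P 0)" by (rule finite_subset) simp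
    then show ?case using inf
      by (intro ordLess_imp_ordLeq finite_ordLess_infinite[OF card_of_Well_order card_of_Well_order])
        (simp_all add: Field_card_of)
  next
    case (Suc n)
    have "?P (Suc n) \<subseteq> (\<lambda>(a, X). insert a X) ` (A \<times> ?P n)"
    proof
      fix X assume "X \<in> ?P (Suc n)"
      then obtain a Z where Z: "X = insert a Z" "a \<notin> Z" "card Z = n" "finite Z" "X \<subseteq> A"
        by (auto simp: Fpow_def card_Suc_eq_finite)
      then have "(a, Z) \<in> A \<times> ?P n" by (auto simp: Fpow_def)
      then show "X \<in> (\<lambda>(a, X). insert a X) ` (A \<times> ?P n)" using Z(1) by force
    qed
    then have "|?P (Suc n)| \<le>o |A \<times> ?P n|"
      using card_of_mono1 card_of_image ordLeq_transitive by blast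
    also have "|A \<times> ?P n| \<le>o |A|"
      using inf Suc by (intro card_of_Times_ordLeq_infinite_Field) (simp_all add: Field_card_of card_of_card_order_on card_of_mono1)
    finally show ?case .
  qed
  then have "|\<Union>n \<in> UNIV :: nat set. ?P n| \<le>o |A|"
    using inf by (intro card_of_UNION_ordLeq_infinite) (auto simp: infinite_iff_card_of_nat)
  moreover have "Fpow A \<subseteq> (\<Union>n. ?P n)" by auto
  ultimately show ?thesis using card_of_mono1 ordLeq_transitive by blast
qed

section \<open>Two-element algebras with unary operations\<close>

definition unary_sig :: "'f set \<Rightarrow> 'f signature" where
  "unary_sig K = \<lparr>syms = K, arity = (\<lambda>_. 1)\<rparr>"

definition flip_alg :: "'a \<Rightarrow> 'a \<Rightarrow> 'f set \<Rightarrow> ('f, 'a) algebra" where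
  "flip_alg p q s = \<lparr>elts = {p, q},
     op_on = (\<lambda>f xs. if f \<in> s then hd xs else if hd xs = p then q else p)\<rparr>"

text \<open>Taking every quasi-identity valid in the algebras with finite \<open>s\<close> makes it
  immediate that these algebras generate.\<close>

definition flip_qis :: "'a \<Rightarrow> 'a \<Rightarrow> 'f set \<Rightarrow> 'f quasi_identity set" where
  "flip_qis p q K =
     {e. wf_qi (unary_sig K) e \<and> (\<forall>s \<in> Fpow K. satisfies (flip_alg p q s :: ('f, 'a) algebra) e)}"

lemma flip_algebra: "is_algebra (unary_sig K) (flip_alg p q s)"
  by (auto simp: is_algebra_def unary_sig_def flip_alg_def length_Suc_conv)

lemma finite_syms_trm: "finite (set1_trm t)"
  by (induction t) auto

lemma val_flip_alg_cong:
  assumes "s \<inter> set1_trm t = s' \<inter> set1_trm t"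
  shows "val (flip_alg p q s) x t = val (flip_alg p q s') x t"
  using assms
proof (induction t)
  case (App f ts)
  have "map (val (flip_alg p q s) x) ts = map (val (flip_alg p q s') x) ts"
  proof (rule map_cong[OF refl])
    fix t assume t: "t \<in> set ts"
    then have "set1_trm t \<subseteq> set1_trm (App f ts)" by auto
    then have "s \<inter> set1_trm t = s' \<inter> set1_trm t" using App.prems by blast
    then show "val (flip_alg p q s) x t = val (flip_alg p q s') x t" by (rule App.IH[OF t])
  qed
  moreover have "f \<in> s \<longleftrightarrow> f \<in> s'" using App.prems by auto
  ultimately show ?case by (simp add: flip_alg_def del: map_eq_conv)
qed simp

text \<open>A quasi-identity mentions finitely many symbols. On these, \<open>s\<close> agrees with
  a finite subset of itself, for which the quasi-identity holds by definition of
  \<open>flip_qis\<close>.\<close>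

lemma flip_alg_models:
  assumes "s \<subseteq> K"
  shows "flip_alg p q s \<in> models (unary_sig K) (flip_qis p q K)"
proof -
  have "satisfies (flip_alg p q s) e" if e: "e \<in> flip_qis p q K" for e
  proof (cases e rule: qi_code.cases)
    case (1 I ps c d)
    let ?F = "set1_trm c \<union> set1_trm d \<union> (\<Union>(a, b) \<in> set ps. set1_trm a \<union> set1_trm b)"
    let ?s = "s \<inter> ?F"
    have "finite ?F" by (auto simp: finite_syms_trm)
    then have "?s \<in> Fpow K" using assms by (auto simp: Fpow_def)
    then have sat: "satisfies (flip_alg p q ?s) e" using e by (simp add: flip_qis_def)
    have v: "val (flip_alg p q s) x t = val (flip_alg p q ?s) x t" if "set1_trm t \<subseteq> ?F" for x t
      by (rule val_flip_alg_cong) (use that in blast)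
    have vc: "val (flip_alg p q s) x c = val (flip_alg p q ?s) x c"
      "val (flip_alg p q s) x d = val (flip_alg p q ?s) x d" for x by (rule v, blast)+
    have vp: "val (flip_alg p q s) x a = val (flip_alg p q ?s) x a"
      "val (flip_alg p q s) x b = val (flip_alg p q ?s) x b" if "(a, b) \<in> set ps" for a b x
      by (rule v, use that in blast)+
    have el: "elts (flip_alg p q s) = elts (flip_alg p q ?s)" by (simp add: flip_alg_def)
    have "val (flip_alg p q s) x c = val (flip_alg p q s) x d"
      if x: "x \<in> I \<rightarrow> elts (flip_alg p q s)"
        and ps: "\<forall>(a, b) \<in> set ps. val (flip_alg p q s) x a = val (flip_alg p q s) x b" for x
    proof -
      have "\<forall>(a, b) \<in> set ps. val (flip_alg p q ?s) x a = val (flip_alg p q ?s) x b"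
        using ps vp by fastforce
      then show ?thesis using sat x unfolding vc el 1 satisfies.simps by blast
    qed
    then show ?thesis unfolding 1 by simp
  qed
  then show ?thesis by (simp add: models_def flip_algebra)
qed

lemma flip_qis_generated:
  fixes p q :: 'a
  shows "generated_by (unary_sig K) (flip_qis p q K) (flip_alg p q ` Fpow K)"
  unfolding generated_by_def
proof (intro conjI allI impI)
  show "flip_alg p q ` Fpow K \<subseteq> models (unary_sig K) (flip_qis p q K)"
    using flip_alg_models by (auto simp: Fpow_def)
  fix E' assume "quasi_identities (unary_sig K) E' \<and> flip_alg p q ` Fpow K \<subseteq> models (unary_sig K) E'"
  then have "E' \<subseteq> flip_qis p q K"
    by (fastforce simp: flip_qis_def quasi_identities_def models_def)
  then show "quasivariety_le (unary_sig K) (flip_qis p q K) E'"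
    by (auto simp: quasivariety_le_def models_def)
qed

(* The quasi-identity f(x) = x ==> f(y) = y makes f the identity on any model containing a
   flip algebra where it is. *)
lemma flip_alg_compatible_subset:
  fixes p q :: 'a and s :: "'f set"
  assumes pq: "p \<noteq> q" and s: "s \<subseteq> K"
    and comp: "compatible (unary_sig K) (flip_qis p q K) Y"
    and Y: "flip_alg p q s \<in> Y" "flip_alg p q t \<in> Y"
  shows "s \<subseteq> t"
proof
  fix \<alpha> assume \<alpha>: "\<alpha> \<in> s"
  then have \<alpha>K: "\<alpha> \<in> syms (unary_sig K)" using s by (auto simp: unary_sig_def)
  let ?e = "QI {0, 1} [(App \<alpha> [Var 0], Var 0)] (App \<alpha> [Var 1], Var 1)"
  \<comment> \<open>The transposition has no fixed point, so in a flip algebra one fixed point of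
    \<alpha> forces \<alpha> to act as the identity.\<close>
  have "?e \<in> flip_qis p q K"
    using \<alpha>K pq by (auto simp: flip_qis_def unary_sig_def flip_alg_def)
  moreover obtain B :: "('f, ('f, ('f, 'a) algebra \<times> 'a) trm) algebra"
    where B: "B \<in> models (unary_sig K) (flip_qis p q K)"
      "\<forall>A \<in> Y. \<exists>h. embedding (unary_sig K) A B h" using comp unfolding compatible_def by blast
  ultimately have sat: "satisfies B ?e" unfolding models_def by blast
  obtain g h where g: "embedding (unary_sig K) (flip_alg p q s) B g"
    and h: "embedding (unary_sig K) (flip_alg p q t) B h" using B(2) Y by blast
  have gB: "g p \<in> elts B" and hB: "h p \<in> elts B"
    using g h by (auto simp: embedding_def alg_hom_def flip_alg_def)
  have "g (op_on (flip_alg p q s) \<alpha> [p]) = op_on B \<alpha> (map g [p])"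
    by (rule alg_homD[OF _ \<alpha>K]) (use g in \<open>auto simp: embedding_def unary_sig_def flip_alg_def\<close>)
  then have "op_on B \<alpha> [g p] = g p" using \<alpha> by (simp add: flip_alg_def)
  then have "op_on B \<alpha> [h p] = h p"
    using sat[unfolded satisfies.simps, THEN bspec, of "\<lambda>n. if n = 0 then g p else h p"] gB hB by simp
  moreover have "h (op_on (flip_alg p q t) \<alpha> [p]) = op_on B \<alpha> (map h [p])"
    by (rule alg_homD[OF _ \<alpha>K]) (use h in \<open>auto simp: embedding_def unary_sig_def flip_alg_def\<close>)
  ultimately have "h (op_on (flip_alg p q t) \<alpha> [p]) = h p" by simp
  moreover have "inj_on h {p, q}" using h by (simp add: embedding_def flip_alg_def)
  ultimately show "\<alpha> \<in> t" using pq by (auto simp: flip_alg_def split: if_splits)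
qed

text \<open>Compatible flip algebras have equal sets \<open>s\<close>, so each part contains at most
  one flip algebra. Cantor's diagonal argument then shows that parts indexed by
  \<open>Field \<kappa>\<close> cannot exhaust its power set.\<close>

lemma flip_algs_not_covered:
  fixes p q :: 'a and \<kappa> :: "'k rel"
  assumes pq: "p \<noteq> q"
  shows "\<not> si_sets_covered TYPE('a) (unary_sig (Field \<kappa>)) (flip_qis p q (Field \<kappa>)) \<kappa>"
proof
  let ?K = "Field \<kappa>"
  let ?X = "flip_alg p q ` Pow ?K :: ('k, 'a) algebra set"
  assume "si_sets_covered TYPE('a) (unary_sig ?K) (flip_qis p q ?K) \<kappa>"
  moreover have "\<forall>A \<in> ?X. subdirectly_irreducible (unary_sig ?K) (flip_qis p q ?K) A"
    using flip_alg_models pq by (auto intro!: two_element_subdirectly_irreducible simp: flip_alg_def)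
  ultimately have "\<exists>Y. ?X = (\<Union>\<alpha> \<in> ?K. Y \<alpha>) \<and>
      (\<forall>\<alpha> \<in> ?K. compatible (unary_sig ?K) (flip_qis p q ?K) (Y \<alpha>))"
    unfolding si_sets_covered_def by blast
  then obtain Y where Y: "?X = (\<Union>\<alpha> \<in> ?K. Y \<alpha>)"
    "\<And>\<alpha>. \<alpha> \<in> ?K \<Longrightarrow> compatible (unary_sig ?K) (flip_qis p q ?K) (Y \<alpha>)" by blast
  \<comment> \<open>The diagonal set: at \<alpha> it is chosen to differ from the set of any flip
    algebra in \<open>Y \<alpha>\<close>.\<close>
  define t where "t = {\<alpha> \<in> ?K. \<not> (\<exists>s \<subseteq> ?K. flip_alg p q s \<in> Y \<alpha> \<and> \<alpha> \<in> s)}"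
  have tK: "t \<subseteq> ?K" by (auto simp: t_def)
  then have "flip_alg p q t \<in> (\<Union>\<alpha> \<in> ?K. Y \<alpha>)" unfolding Y(1)[symmetric] by blast
  then obtain \<alpha> where \<alpha>: "\<alpha> \<in> ?K" "flip_alg p q t \<in> Y \<alpha>" by blast
  show False
  proof (cases "\<alpha> \<in> t")
    case True
    then show False using \<alpha>(2) tK by (auto simp: t_def)
  next
    case False
    then obtain s where s: "s \<subseteq> ?K" "flip_alg p q s \<in> Y \<alpha>" "\<alpha> \<in> s" using \<alpha>(1) by (auto simp: t_def)
    then have "s \<subseteq> t" using flip_alg_compatible_subset[OF pq s(1) Y(2)[OF \<alpha>(1)] s(2) \<alpha>(2)] by blast
    then show False using s(3) False by blast
  qed
qed

(* "Every set of subdirectly irreducible algebras" ranges over sets of algebras with elements in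
   'a, for an arbitrary infinite type 'a. For the first implication 'a must be large enough to hold
   the countably generated algebras; assuming the covering condition only over such an 'a is weaker
   than assuming it over all types. *)
theorem corollary26:
  fixes \<kappa> :: "'k rel"
  assumes "Card_order \<kappa>" and "infinite (UNIV :: 'a set)"
  shows
    "(\<forall>(S :: 'f signature) E. quasi_identities S E \<and> |syms S| \<le>o |UNIV :: 'a set| \<longrightarrow>
        si_sets_covered TYPE('a) S E \<kappa> \<longrightarrow> generated_by_at_most S E \<kappa>) \<and>
     (finite (Field \<kappa>) \<longrightarrow>
        (\<forall>(S :: 'f signature) E. quasi_identities S E \<longrightarrow>
           generated_by_at_most S E \<kappa> \<longrightarrow> si_sets_covered TYPE('a) S E \<kappa>)) \<and>
     (infinite (Field \<kappa>) \<longrightarrow>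
        (\<exists>(S :: 'k signature) E. quasi_identities S E \<and>
           generated_by_at_most S E \<kappa> \<and> \<not> si_sets_covered TYPE('a) S E \<kappa>))"
proof (intro conjI allI impI)
  fix S :: "'f signature" and E
  assume "quasi_identities S E \<and> |syms S| \<le>o |UNIV :: 'a set|" "si_sets_covered TYPE('a) S E \<kappa>"
  then show "generated_by_at_most S E \<kappa>"
    using generated_by_at_most_if_covered[OF assms] by blast
next
  fix S :: "'f signature" and E
  assume "finite (Field \<kappa>)" "quasi_identities S E" "generated_by_at_most S E \<kappa>"
  then show "si_sets_covered TYPE('a) S E \<kappa>" by (rule covered_if_generated_by_finite[OF assms(1)])
next
  assume inf: "infinite (Field \<kappa>)"
  obtain p q :: 'a where pq: "p \<noteq> q"
    using assms(2) by (metis (full_types) UNIV_eq_I finite.simps insertCI)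
  \<comment> \<open>The elements of \<open>Field \<kappa>\<close> are both the symbols and the
    indices of the parts of a covering, which is what the diagonal argument compares.\<close>
  let ?S = "unary_sig (Field \<kappa>)" and ?E = "flip_qis p q (Field \<kappa>)"
  have E: "quasi_identities ?S ?E" by (simp add: quasi_identities_def flip_qis_def)
  have "|flip_alg p q ` Fpow (Field \<kappa>)| \<le>o |Field \<kappa>|"
    using card_of_image card_of_Fpow_infinite[OF inf] ordLeq_transitive by blast
  then have "|flip_alg p q ` Fpow (Field \<kappa>)| \<le>o \<kappa>"
    using card_of_Field_ordIso[OF assms(1)] ordLeq_ordIso_trans by blast
  then have "generated_by_at_most ?S ?E \<kappa>"
    by (rule generated_by_at_most_universal[OF E _ flip_qis_generated])
  then show "\<exists>(S :: 'k signature) E. quasi_identities S E \<and>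
      generated_by_at_most S E \<kappa> \<and> \<not> si_sets_covered TYPE('a) S E \<kappa>"
    using E flip_algs_not_covered[OF pq] by blast
qed

end
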